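(* Let $I:=(-1,1)$ and let $a_i$, $b_i$, $c_i$, $i=1,2$, be four times continuously differentiable functions on $[-1,1]$ satisfying, for some $\eta>0$, $$\min\{a_1(x),a_2(x)\}\ge\eta>0 \quad\text{and}\quad \max\{c_1(x),c_2(x)\}\le 0, \qquad x\in[-1,1].$$ Let $\mathcal{L}$ be the fourth-order elliptic operator $$\mathcal{L}u := A_4(x)u''''+A_3(x)u'''+A_2(x)u''+A_1(x)u'+A_0(x)u$$ with \begin{align*} A_4&:=a_1a_2, \qquad A_3:=(2a_1'+b_1)a_2+a_1b_2,\\ A_2&:=(a_1''+2b_1'+c_1)a_2+(a_1'+b_1)b_2+a_1c_2,\\ A_1&:=(b_1''+2c_1')a_2+(b_1'+c_1)b_2+b_1c_2,\\ A_0&:=c_1''a_2+c_1'b_2+c_1c_2. \end{align*} Then the eigenvalue problem $$\mathcal{L}\phi=\mu\phi \ \text{ in } I, \qquad \phi(\pm1)=\phi'(\pm1)=0,$$ has an eigenvalue $\mu_1>0$ with a corresponding eigenfunction $\phi_1>0$ in $I$, and $\mu_1$ is the only eigenvalue with a positive eigenfunction. Moreover, any eigenfunction corresponding to the eigenvalue $\mu_1$ is a scalar multiple of $\phi_1$. *)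

theory Defs
  imports "HOL-Analysis.Analysis"
begin

text \<open>Derivatives on a set \<open>S\<close> are taken within \<open>S\<close>: for \<open>S = {-1..1}\<close> they are the ordinary
  derivatives in the interior and one-sided at the end points. They depend only on the values of
  the function on \<open>S\<close>.\<close>

definition deriv_on :: "real set \<Rightarrow> (real \<Rightarrow> real) \<Rightarrow> real \<Rightarrow> real" where
  "deriv_on S f = (\<lambda>x. vector_derivative f (at x within S))"

primrec C_on :: "nat \<Rightarrow> real set \<Rightarrow> (real \<Rightarrow> real) \<Rightarrow> bool" where
  "C_on 0 S f \<longleftrightarrow> continuous_on S f"
| "C_on (Suc k) S f \<longleftrightarrow> f differentiable_on S \<and> C_on k S (deriv_on S f)"

abbreviation D :: "nat \<Rightarrow> (real \<Rightarrow> real) \<Rightarrow> real \<Rightarrow> real" where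
  "D k \<equiv> deriv_on {-1..1} ^^ k"

definition A4 :: "(real \<Rightarrow> real) \<Rightarrow> (real \<Rightarrow> real) \<Rightarrow> real \<Rightarrow> real" where
  "A4 a1 a2 x = a1 x * a2 x"

definition A3 ::
  "(real \<Rightarrow> real) \<Rightarrow> (real \<Rightarrow> real) \<Rightarrow> (real \<Rightarrow> real) \<Rightarrow> (real \<Rightarrow> real) \<Rightarrow> real \<Rightarrow> real" where
  "A3 a1 b1 a2 b2 x = (2 * D 1 a1 x + b1 x) * a2 x + a1 x * b2 x"

definition A2 ::
  "(real \<Rightarrow> real) \<Rightarrow> (real \<Rightarrow> real) \<Rightarrow> (real \<Rightarrow> real) \<Rightarrow>
   (real \<Rightarrow> real) \<Rightarrow> (real \<Rightarrow> real) \<Rightarrow> (real \<Rightarrow> real) \<Rightarrow> real \<Rightarrow> real" where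
  "A2 a1 b1 c1 a2 b2 c2 x =
     (D 2 a1 x + 2 * D 1 b1 x + c1 x) * a2 x + (D 1 a1 x + b1 x) * b2 x + a1 x * c2 x"

definition A1 ::
  "(real \<Rightarrow> real) \<Rightarrow> (real \<Rightarrow> real) \<Rightarrow>
   (real \<Rightarrow> real) \<Rightarrow> (real \<Rightarrow> real) \<Rightarrow> (real \<Rightarrow> real) \<Rightarrow> real \<Rightarrow> real" where
  "A1 b1 c1 a2 b2 c2 x =
     (D 2 b1 x + 2 * D 1 c1 x) * a2 x + (D 1 b1 x + c1 x) * b2 x + b1 x * c2 x"

definition A0 ::
  "(real \<Rightarrow> real) \<Rightarrow> (real \<Rightarrow> real) \<Rightarrow> (real \<Rightarrow> real) \<Rightarrow> (real \<Rightarrow> real) \<Rightarrow> real \<Rightarrow> real" where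
  "A0 c1 a2 b2 c2 x = D 2 c1 x * a2 x + D 1 c1 x * b2 x + c1 x * c2 x"

definition L ::
  "(real \<Rightarrow> real) \<Rightarrow> (real \<Rightarrow> real) \<Rightarrow> (real \<Rightarrow> real) \<Rightarrow>
   (real \<Rightarrow> real) \<Rightarrow> (real \<Rightarrow> real) \<Rightarrow> (real \<Rightarrow> real) \<Rightarrow> (real \<Rightarrow> real) \<Rightarrow> real \<Rightarrow> real" where
  "L a1 b1 c1 a2 b2 c2 u x =
     A4 a1 a2 x * D 4 u x
     + A3 a1 b1 a2 b2 x * D 3 u x
     + A2 a1 b1 c1 a2 b2 c2 x * D 2 u x
     + A1 b1 c1 a2 b2 c2 x * D 1 u x
     + A0 c1 a2 b2 c2 x * u x"

text \<open>Classical real eigenfunctions with clamped boundary conditions. Only the values of \<open>\<phi>\<close> on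
  \<open>{-1..1}\<close> matter. Requiring \<open>\<phi>\<close> to be four times continuously differentiable up to the
  boundary loses no classical solution: if \<open>a1\<close> and \<open>a2\<close> are bounded below by a positive constant,
  any solution of the equation in the open interval extends in this way.\<close>

definition is_eigenfunction ::
  "((real \<Rightarrow> real) \<Rightarrow> real \<Rightarrow> real) \<Rightarrow> real \<Rightarrow> (real \<Rightarrow> real) \<Rightarrow> bool" where
  "is_eigenfunction Op \<mu> \<phi> \<longleftrightarrow>
     C_on 4 {-1..1} \<phi> \<and>
     (\<forall>x\<in>{-1<..<1}. Op \<phi> x = \<mu> * \<phi> x) \<and>
     \<phi> (-1) = 0 \<and> \<phi> 1 = 0 \<and> D 1 \<phi> (-1) = 0 \<and> D 1 \<phi> 1 = 0 \<and>
     (\<exists>x\<in>{-1..1}. \<phi> x \<noteq> 0)"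

end

theory Submission
  imports Defs "HOL-Complex_Analysis.Great_Picard"
begin

text \<open>
  The operator is the composition \<open>L\<^sub>2 \<circ> L\<^sub>1\<close> of \<open>L\<^sub>i u = a\<^sub>i u'' + b\<^sub>i u' + c\<^sub>i u\<close>. Since \<open>c\<^sub>i \<le> 0\<close>, the
  solution of \<open>L\<^sub>i v\<^sub>i = 0\<close> with \<open>v\<^sub>i(-1) = 1\<close> and \<open>v\<^sub>i'(-1) = 0\<close> satisfies a Volterra equation with a
  nonnegative kernel, so \<open>v\<^sub>i \<ge> 1\<close> on the closed interval (\<open>positive_solution\<close>). Dividing by it
  removes the term of order zero: if \<open>B\<^sub>i' = b\<^sub>i / a\<^sub>i\<close>, then
  \<open>L\<^sub>i u = a\<^sub>i / (v\<^sub>i exp B\<^sub>i) (v\<^sub>i\<^sup>2 exp B\<^sub>i (u / v\<^sub>i)')'\<close>. With \<open>w = \<phi> / v\<^sub>1\<close> the clamped eigenvalue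
  problem therefore becomes a chain of first order equations
  \<open>w' = k\<^sub>1 z\<^sub>1\<close>, \<open>z\<^sub>1' = k\<^sub>2 z\<^sub>2\<close>, \<open>z\<^sub>2' = k\<^sub>3 z\<^sub>3\<close>, \<open>z\<^sub>3' = \<mu> m w\<close> with positive weights, where \<open>w\<close> and
  \<open>z\<^sub>1\<close> vanish at both end points. In general \<open>k\<^sub>1 \<noteq> k\<^sub>3\<close>, so the problem is not self-adjoint and
  calls for an argument with positive operators instead of a variational one.

  The chain with \<open>z\<^sub>3' = h \<ge> 0\<close> preserves positivity. The nondecreasing function \<open>z\<^sub>3\<close> changes sign at
  most once, at \<open>\<gamma>\<close> say, so \<open>z\<^sub>2\<close> decreases up to \<open>\<gamma>\<close> and increases from there on. Integrating twice
  from the left end point preserves monotonicity of quotients (\<open>ratio_mono\<close>), so \<open>w / E\<close> is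
  nonincreasing on the left of \<open>\<gamma>\<close>, where \<open>E\<close> is the solution of the same two integrations with
  \<open>z\<^sub>2 = 1\<close>; the mirror image holds on the right. Everything thus reduces to the single value \<open>w \<gamma>\<close>,
  which is nonnegative and vanishes only if \<open>w = 0\<close> (\<open>clamped_pivot\<close>). Consequently the solution
  operator \<open>T\<close> maps every nonnegative \<open>f \<noteq> 0\<close> above a positive multiple of a fixed function \<open>envelope\<close>,
  and every \<open>T g\<close> lies below some multiple of it, so \<open>T f\<close> dominates a positive multiple of \<open>T g\<close>.

  This domination and the compactness of \<open>T\<close> give a Krein-Rutman theorem. For existence, take the
  supremum \<open>\<rho>\<close> of all \<open>l\<close> with \<open>l u \<le> T u\<close> for some nonnegative \<open>u \<noteq> 0\<close>; a limit of almost optimal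
  functions attains it, and if \<open>T g \<noteq> \<rho> g\<close> there, then another application of \<open>T\<close> would improve \<open>\<rho>\<close>
  (\<open>positive_eigenfunction_exists\<close>). For uniqueness and simplicity, subtract from one positive
  eigenfunction the largest multiple of another one that stays below it: unless the difference
  is zero, domination would allow an even larger multiple (\<open>eigenfunctions_proportional\<close>).
\<close>

section \<open>Calculus on the closed interval\<close>

abbreviation (input) Ibar :: "real set" where
  "Ibar \<equiv> {-1..1}"

text \<open>
  One-sided at the end points, and stated as a relation between functions on the closed interval:
  chains of differential equations are then compositions of this relation, and the values outside
  the interval never matter.
\<close>

definition has_slope :: "(real \<Rightarrow> real) \<Rightarrow> (real \<Rightarrow> real) \<Rightarrow> bool" where
  "has_slope f f' \<longleftrightarrow> (\<forall>x\<in>Ibar. (f has_real_derivative f' x) (at x within Ibar))"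

lemma has_slope_continuous: "has_slope f f' \<Longrightarrow> continuous_on Ibar f"
  unfolding has_slope_def by (meson DERIV_continuous_on)

lemma has_slope_cong:
  assumes "has_slope f f'" "\<And>x. x \<in> Ibar \<Longrightarrow> f x = g x" "\<And>x. x \<in> Ibar \<Longrightarrow> f' x = g' x"
  shows "has_slope g g'"
  unfolding has_slope_def
proof
  fix x :: real assume x: "x \<in> Ibar"
  have "(f has_real_derivative g' x) (at x within Ibar)"
    using assms(1,3) x by (simp add: has_slope_def)
  then show "(g has_real_derivative g' x) (at x within Ibar)"
    by (rule has_field_derivative_transform_within[OF _ zero_less_one x]) (rule assms(2))
qed

text \<open>
  At an end point the one-sided derivative is still unique, because every point of the interval is
  a limit point of it.
\<close>

lemma has_slope_unique:
  assumes "has_slope f f'" "has_slope f f''" "x \<in> Ibar"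
  shows "f' x = f'' x"
proof -
  have "x islimpt Ibar" using assms(3) by (intro connected_imp_perfect) auto
  then have "at x within Ibar \<noteq> bot" by (simp add: trivial_limit_within)
  moreover have "(f has_vector_derivative f' x) (at x within Ibar)"
    "(f has_vector_derivative f'' x) (at x within Ibar)"
    using assms by (simp_all add: has_slope_def has_real_derivative_iff_has_vector_derivative)
  ultimately show ?thesis by (rule vector_derivative_unique_within)
qed

lemma has_slope_const: "has_slope (\<lambda>x. c) (\<lambda>x. 0)"
  unfolding has_slope_def by (auto intro!: derivative_eq_intros)

lemma has_slope_add:
  "has_slope f f' \<Longrightarrow> has_slope g g' \<Longrightarrow> has_slope (\<lambda>x. f x + g x) (\<lambda>x. f' x + g' x)"
  unfolding has_slope_def by (auto intro!: derivative_eq_intros)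

lemma has_slope_mult:
  "has_slope f f' \<Longrightarrow> has_slope g g' \<Longrightarrow>
    has_slope (\<lambda>x. f x * g x) (\<lambda>x. f' x * g x + f x * g' x)"
  unfolding has_slope_def by (auto intro!: derivative_eq_intros)

lemma has_slope_cmult: "has_slope f f' \<Longrightarrow> has_slope (\<lambda>x. c * f x) (\<lambda>x. c * f' x)"
  unfolding has_slope_def by (auto intro!: derivative_eq_intros)

lemma has_slope_divide:
  assumes "has_slope f f'" "has_slope g g'" "\<And>x. x \<in> Ibar \<Longrightarrow> g x \<noteq> 0"
  shows "has_slope (\<lambda>x. f x / g x) (\<lambda>x. (f' x * g x - f x * g' x) / (g x * g x))"
  using assms unfolding has_slope_def by (auto intro!: derivative_eq_intros)

lemma has_slope_exp: "has_slope f f' \<Longrightarrow> has_slope (\<lambda>x. exp (f x)) (\<lambda>x. exp (f x) * f' x)"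
  unfolding has_slope_def by (auto intro!: derivative_eq_intros)

lemma has_slope_mono:
  assumes f: "has_slope f f'" and le: "x \<le> y" "-1 \<le> x" "y \<le> 1"
    and pos: "\<And>t. x \<le> t \<Longrightarrow> t \<le> y \<Longrightarrow> 0 \<le> f' t"
  shows "f x \<le> f y"
proof (rule DERIV_nonneg_imp_increasing_open[OF le(1)])
  fix t assume t: "x < t" "t < y"
  then have "(f has_real_derivative f' t) (at t within Ibar)"
    using f le by (simp add: has_slope_def)
  moreover have "at t within Ibar = at t"
    using t le by (intro at_within_interior) auto
  ultimately show "\<exists>d. (f has_real_derivative d) (at t) \<and> 0 \<le> d"
    using pos t by auto
next
  show "continuous_on {x..y} f"
    using has_slope_continuous[OF f] by (rule continuous_on_subset) (use le in simp)
qed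

lemma has_slope_antimono:
  assumes f: "has_slope f f'" and le: "x \<le> y" "-1 \<le> x" "y \<le> 1"
    and neg: "\<And>t. x \<le> t \<Longrightarrow> t \<le> y \<Longrightarrow> f' t \<le> 0"
  shows "f y \<le> f x"
  using has_slope_mono[OF has_slope_cmult[OF f, of "-1"] le] neg by force

lemma has_slope_zero:
  assumes f: "has_slope f f'" and z: "\<And>x. x \<in> Ibar \<Longrightarrow> f x = 0" and x: "x \<in> Ibar"
  shows "f' x = 0"
  by (rule has_slope_unique[OF f _ x], rule has_slope_cong[OF has_slope_const[of 0]]) (use z in auto)

lemma has_slope_eq:
  assumes f: "has_slope f f'" and g: "has_slope g f'" and "f (-1) = g (-1)" and x: "x \<in> Ibar"
  shows "f x = g x"
proof -
  have h: "has_slope (\<lambda>x. f x + -1 * g x) (\<lambda>x. f' x + -1 * f' x)"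
    by (intro has_slope_add has_slope_cmult f g)
  show ?thesis
    using has_slope_mono[OF h, of "-1" x] has_slope_antimono[OF h, of "-1" x] x assms(3) by auto
qed

lemma continuous_bounded:
  fixes f :: "real \<Rightarrow> real"
  assumes "continuous_on Ibar f"
  obtains B where "0 < B" "\<And>x. x \<in> Ibar \<Longrightarrow> \<bar>f x\<bar> \<le> B"
proof -
  have "compact (f ` Ibar)" by (rule compact_continuous_image[OF assms]) simp
  then have "bounded (f ` Ibar)" by (rule compact_imp_bounded)
  then obtain B where B: "0 < B" "\<forall>y\<in>f ` Ibar. norm y \<le> B"
    unfolding bounded_pos by blast
  show thesis by (rule that[OF B(1)]) (metis B(2) imageI real_norm_def)
qed

lemma continuous_pos_lower_bound:
  fixes f :: "real \<Rightarrow> real"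
  assumes "continuous_on Ibar f" "\<And>x. x \<in> Ibar \<Longrightarrow> 0 < f x"
  obtains d where "0 < d" "\<And>x. x \<in> Ibar \<Longrightarrow> d \<le> f x"
proof -
  obtain x where x: "x \<in> Ibar" "\<forall>y\<in>Ibar. f x \<le> f y"
    using continuous_attains_inf[of Ibar f] assms(1) by auto
  show thesis by (rule that[OF assms(2)[OF x(1)]]) (rule bspec[OF x(2)])
qed

definition prim :: "(real \<Rightarrow> real) \<Rightarrow> real \<Rightarrow> real" where
  "prim f x = integral {-1..x} f"

lemma prim_left [simp]: "prim f (-1) = 0"
  by (simp add: prim_def)

lemma prim_slope: "continuous_on Ibar f \<Longrightarrow> has_slope (prim f) f"
  unfolding has_slope_def prim_def by (auto intro: integral_has_real_derivative)

lemma prim_continuous: "continuous_on Ibar f \<Longrightarrow> continuous_on Ibar (prim f)"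
  by (rule has_slope_continuous[OF prim_slope])

lemma prim_nonneg:
  assumes "continuous_on Ibar f" "x \<in> Ibar" "\<And>t. t \<in> Ibar \<Longrightarrow> 0 \<le> f t"
  shows "0 \<le> prim f x"
  using has_slope_mono[OF prim_slope[OF assms(1)], of "-1" x] assms by auto

text \<open>
  The integrand has a positive lower bound \<open>d\<close> by compactness, so the primitive lies above
  \<open>d (x + 1)\<close>.
\<close>

lemma prim_pos:
  assumes "continuous_on Ibar f" "x \<in> {-1<..1}" "\<And>t. t \<in> Ibar \<Longrightarrow> 0 < f t"
  shows "0 < prim f x"
proof -
  obtain d where d: "0 < d" "\<And>x. x \<in> Ibar \<Longrightarrow> d \<le> f x"
    by (rule continuous_pos_lower_bound[OF assms(1,3)]) auto
  have "has_slope (\<lambda>x. prim f x + -d * x) (\<lambda>x. f x + -d * 1)"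
    by (intro has_slope_add has_slope_cmult prim_slope assms) (auto simp: has_slope_def)
  from has_slope_mono[OF this, of "-1" x] d(2) assms(2) have "d * (x + 1) \<le> prim f x"
    by (auto simp: algebra_simps)
  moreover have "0 < d * (x + 1)" using d assms(2) by auto
  ultimately show ?thesis by linarith
qed

lemma prim_abs_bound:
  assumes c: "continuous_on Ibar f" and b: "\<And>t. t \<in> Ibar \<Longrightarrow> \<bar>f t\<bar> \<le> B" and x: "x \<in> Ibar"
  shows "\<bar>prim f x\<bar> \<le> 2 * B"
proof -
  have B: "0 \<le> B" using b[of 0] by auto
  have id: "has_slope (\<lambda>x. B * x) (\<lambda>x. B * 1)"
    by (intro has_slope_cmult) (auto simp: has_slope_def)
  have 1: "has_slope (\<lambda>x. B * x + prim f x) (\<lambda>x. B * 1 + f x)"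
    by (intro has_slope_add id prim_slope c)
  have 2: "has_slope (\<lambda>x. B * x + -1 * prim f x) (\<lambda>x. B * 1 + -1 * f x)"
    by (intro has_slope_add has_slope_cmult id prim_slope c)
  have "- prim f x \<le> B * x + B"
    using has_slope_mono[OF 1, of "-1" x] b x by (auto simp: abs_le_iff; smt (verit) b atLeastAtMost_iff)
  moreover have "prim f x \<le> B * x + B"
    using has_slope_mono[OF 2, of "-1" x] b x by (auto simp: abs_le_iff)
  moreover have "B * x \<le> B" using x B by (simp add: mult_left_le)
  ultimately show ?thesis by linarith
qed

section \<open>Chains of first order equations with clamped ends\<close>

text \<open>
  A monotone form of l'Hopital's rule: if \<open>\<phi> / \<psi>\<close> is nonincreasing, then so is the quotient \<open>A / Q\<close>
  of the integrals of \<open>\<phi>\<close> and \<open>\<psi>\<close> against the weight \<open>k\<close>. Both quotients appear cross-multiplied,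
  which spares all discussion of zeros of the denominators.
\<close>

lemma ratio_mono:
  assumes A: "has_slope A (\<lambda>x. k x * \<phi> x)" "A (-1) = 0"
    and Q: "has_slope Q (\<lambda>x. k x * \<psi> x)" "Q (-1) = 0"
    and k: "\<And>x. x \<in> Ibar \<Longrightarrow> 0 \<le> k x"
    and ratio: "\<And>s t. -1 \<le> s \<Longrightarrow> s \<le> t \<Longrightarrow> t \<le> c \<Longrightarrow> \<phi> t * \<psi> s \<le> \<phi> s * \<psi> t"
    and xy: "-1 \<le> x" "x \<le> y" "y \<le> c" "c \<le> 1"
  shows "A y * Q x \<le> A x * Q y"
proof -
  \<comment> \<open>First integrate the hypothesis in its smaller argument \<open>s\<close> from \<open>-1\<close> to \<open>x\<close>, and
    afterwards the result in its larger argument \<open>t\<close> from \<open>x\<close> to \<open>y\<close>.\<close>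
  have mixed: "Q x * \<phi> t \<le> A x * \<psi> t" if t: "x \<le> t" "t \<le> c" for t
  proof -
    have s: "has_slope (\<lambda>s. \<psi> t * A s + - \<phi> t * Q s)
        (\<lambda>s. \<psi> t * (k s * \<phi> s) + - \<phi> t * (k s * \<psi> s))"
      by (intro has_slope_add has_slope_cmult A Q)
    have pos: "0 \<le> \<psi> t * (k s * \<phi> s) + - \<phi> t * (k s * \<psi> s)" if "-1 \<le> s" "s \<le> x" for s
    proof -
      have "0 \<le> k s * (\<phi> s * \<psi> t - \<phi> t * \<psi> s)"
        using ratio[of s t] k[of s] that t xy by (intro mult_nonneg_nonneg) auto
      then show ?thesis by (simp add: algebra_simps)
    qed
    have "0 \<le> \<psi> t * A x + - \<phi> t * Q x"
      using has_slope_mono[OF s, of "-1" x, OF _ _ _ pos] xy A(2) Q(2) by simp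
    then show ?thesis by (simp add: algebra_simps)
  qed
  have s: "has_slope (\<lambda>t. A x * Q t + - Q x * A t)
      (\<lambda>t. A x * (k t * \<psi> t) + - Q x * (k t * \<phi> t))"
    by (intro has_slope_add has_slope_cmult A Q)
  have pos: "0 \<le> A x * (k t * \<psi> t) + - Q x * (k t * \<phi> t)" if "x \<le> t" "t \<le> y" for t
  proof -
    have "0 \<le> k t * (A x * \<psi> t - Q x * \<phi> t)"
      using mixed[of t] k[of t] that xy by (intro mult_nonneg_nonneg) auto
    then show ?thesis by (simp add: algebra_simps)
  qed
  have "A x * Q x + - Q x * A x \<le> A x * Q y + - Q x * A y"
    using has_slope_mono[OF s, of x y, OF _ _ _ pos] xy by simp
  then show ?thesis by (simp add: algebra_simps)
qed

lemma has_slope_reflect: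
  assumes "has_slope f f'"
  shows "has_slope (\<lambda>x. f (- x)) (\<lambda>x. - f' (- x))"
  unfolding has_slope_def
proof
  fix x :: real assume x: "x \<in> Ibar"
  have im: "uminus ` Ibar = Ibar" by (simp add: image_uminus_atLeastAtMost)
  have "(f has_real_derivative f' (- x)) (at (- x) within uminus ` Ibar)"
    unfolding im using assms x by (auto simp: has_slope_def)
  moreover have "(uminus has_real_derivative -1) (at x within Ibar)"
    by (auto intro!: derivative_eq_intros)
  ultimately have "(f \<circ> uminus has_real_derivative f' (- x) * -1) (at x within Ibar)"
    by (rule DERIV_image_chain)
  then show "((\<lambda>x. f (- x)) has_real_derivative - f' (- x)) (at x within Ibar)"
    by (simp add: o_def)
qed

text \<open>
  A nondecreasing function changes sign at most once. If it has only one sign, the pivot \<open>\<gamma>\<close> is an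
  end point; the side that degenerates to this point then carries no sign information, which is
  harmless because a function is trivially monotone on a single point.
\<close>

lemma has_slope_sign_change:
  assumes z: "has_slope z h" and h: "\<And>x. x \<in> Ibar \<Longrightarrow> 0 \<le> h x"
  obtains \<gamma> where "\<gamma> \<in> Ibar"
    "\<gamma> = -1 \<or> (\<forall>x\<in>{-1..\<gamma>}. z x \<le> 0)" "\<gamma> = 1 \<or> (\<forall>x\<in>{\<gamma>..1}. 0 \<le> z x)"
proof -
  have mono: "z x \<le> z y" if "-1 \<le> x" "x \<le> y" "y \<le> 1" for x y
    by (rule has_slope_mono[OF z]) (use that h in auto)
  consider "0 \<le> z (-1)" | "z 1 \<le> 0" | "z (-1) \<le> 0" "0 \<le> z 1" by linarith
  then show thesis
  proof cases
    case 1
    show thesis by (rule that[of "-1"]) (use 1 mono[of "-1"] in force)+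
  next
    case 2
    show thesis by (rule that[of 1]) (use 2 mono[of _ 1] in force)+
  next
    case 3
    obtain \<gamma> where \<gamma>: "-1 \<le> \<gamma>" "\<gamma> \<le> 1" "z \<gamma> = 0"
      using IVT'[of z "-1" 0 1] 3 has_slope_continuous[OF z] by auto
    show thesis by (rule that[of \<gamma>]) (use \<gamma> mono[of _ \<gamma>] mono[of \<gamma>] in force)+
  qed
qed

text \<open>
  The chain \<open>w' = k\<^sub>1 z\<^sub>1\<close>, \<open>z\<^sub>1' = k\<^sub>2 z\<^sub>2\<close>, \<open>z\<^sub>2' = k\<^sub>3 z\<^sub>3\<close>, \<open>z\<^sub>3' = h\<close> is the factored equation
  \<open>((((w' / k\<^sub>1)' / k\<^sub>2)' / k\<^sub>3)' = h\<close>. Keeping the intermediate quantities as separate functions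
  avoids differentiating the weights, which are merely continuous.
\<close>

locale positive_chain =
  fixes k1 k2 k3 :: "real \<Rightarrow> real"
  assumes cont: "continuous_on Ibar k1" "continuous_on Ibar k2" "continuous_on Ibar k3"
    and pos: "\<And>x. x \<in> Ibar \<Longrightarrow> 0 < k1 x" "\<And>x. x \<in> Ibar \<Longrightarrow> 0 < k2 x" "\<And>x. x \<in> Ibar \<Longrightarrow> 0 < k3 x"
begin

definition clamped ::
  "(real \<Rightarrow> real) \<Rightarrow> (real \<Rightarrow> real) \<Rightarrow> (real \<Rightarrow> real) \<Rightarrow> (real \<Rightarrow> real) \<Rightarrow> (real \<Rightarrow> real) \<Rightarrow> bool" where
  "clamped w z1 z2 z3 h \<longleftrightarrow>
    has_slope w (\<lambda>x. k1 x * z1 x) \<and> has_slope z1 (\<lambda>x. k2 x * z2 x) \<and>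
    has_slope z2 (\<lambda>x. k3 x * z3 x) \<and> has_slope z3 h \<and>
    w (-1) = 0 \<and> w 1 = 0 \<and> z1 (-1) = 0 \<and> z1 1 = 0"

text \<open>
  \<open>Q\<close> and \<open>E\<close> play the roles of \<open>x + 1\<close> and \<open>(x + 1)\<^sup>2 / 2\<close>: they are what \<open>z\<^sub>1\<close> and \<open>w\<close> become when
  \<open>z\<^sub>2 = 1\<close> and both start from zero at the left end point.
\<close>

definition Q :: "real \<Rightarrow> real" where "Q = prim k2"
definition E :: "real \<Rightarrow> real" where "E = prim (\<lambda>x. k1 x * Q x)"

lemma Q_slope: "has_slope Q k2"
  unfolding Q_def by (rule prim_slope[OF cont(2)])

lemma E_slope: "has_slope E (\<lambda>x. k1 x * Q x)"
  unfolding E_def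
  by (intro prim_slope continuous_on_mult cont has_slope_continuous[OF Q_slope])

lemma Q_pos: "x \<in> {-1<..1} \<Longrightarrow> 0 < Q x"
  unfolding Q_def by (rule prim_pos[OF cont(2) _ pos(2)])

lemma Q_E_left: "Q (-1) = 0" "E (-1) = 0"
  by (simp_all add: Q_def E_def)

lemma Q_nonneg: "x \<in> Ibar \<Longrightarrow> 0 \<le> Q x"
  using Q_pos[of x] Q_E_left by (cases "x = -1") auto

text \<open>
  The integrand of \<open>E\<close> vanishes at the left end point, so strict positivity needs an argument: \<open>E\<close> is
  nondecreasing, and \<open>E x = 0\<close> would make it constant on the left of \<open>x\<close>, where its slope is positive.
\<close>

lemma E_pos: assumes "x \<in> {-1<..1}" shows "0 < E x"
proof (rule ccontr)
  assume "\<not> 0 < E x"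
  have mono: "E s \<le> E t" if "-1 \<le> s" "s \<le> t" "t \<le> x" for s t
    by (rule has_slope_mono[OF E_slope]) (use that assms mult_nonneg_nonneg[OF less_imp_le[OF pos(1)] Q_nonneg] in simp_all)
  have E0: "E s = 0" if "s \<in> {-1..x}" for s
    using mono[of "-1" s] mono[of s x] that \<open>\<not> 0 < E x\<close> assms Q_E_left by auto
  define m where "m = (x - 1) / 2"
  have m: "-1 < m" "m < x" "m \<in> Ibar" using assms by (auto simp: m_def field_simps)
  have "(E has_real_derivative k1 m * Q m) (at m within Ibar)"
    using E_slope m by (simp add: has_slope_def)
  then have 1: "(E has_real_derivative k1 m * Q m) (at m)"
    using at_within_interior[of m Ibar] m assms by auto
  have "((\<lambda>x. 0) has_real_derivative k1 m * Q m) (at m)"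
    by (rule has_field_derivative_transform_within_open[OF 1, of "{-1<..<x}"]) (use m E0 in auto)
  then have "k1 m * Q m = 0"
    using DERIV_unique[OF _ DERIV_const] by blast
  then show False using pos(1)[OF m(3)] Q_pos[of m] m by auto
qed

lemma E_nonneg: "x \<in> Ibar \<Longrightarrow> 0 \<le> E x"
  using E_pos[of x] Q_E_left by (cases "x = -1") auto

text \<open>
  If \<open>z\<^sub>2\<close> is nonincreasing up to \<open>\<gamma>\<close>, then two applications of \<open>ratio_mono\<close> show that \<open>z\<^sub>1 / Q\<close> and
  \<open>w / E\<close> are nonincreasing there. The last claim compares the two quotients at \<open>\<gamma>\<close> itself: it bounds
  \<open>w \<gamma>\<close> from below as soon as \<open>z\<^sub>1 \<gamma> \<ge> 0\<close>.
\<close>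

lemma left_half:
  assumes w: "has_slope w (\<lambda>x. k1 x * z1 x)" "w (-1) = 0"
    and z1: "has_slope z1 (\<lambda>x. k2 x * z2 x)" "z1 (-1) = 0"
    and z2: "antimono_on {-1..\<gamma>} z2"
    and \<gamma>: "\<gamma> \<in> Ibar"
  shows "x \<in> {-1..\<gamma>} \<Longrightarrow> z1 \<gamma> * Q x \<le> z1 x * Q \<gamma>"
    and "x \<in> {-1..\<gamma>} \<Longrightarrow> w \<gamma> * E x \<le> w x * E \<gamma>"
    and "z1 \<gamma> * E \<gamma> \<le> w \<gamma> * Q \<gamma>"
proof -
  have Q1: "has_slope Q (\<lambda>x. k2 x * 1)" using Q_slope by simp
  have r: "z1 t * Q s \<le> z1 s * Q t" if "-1 \<le> s" "s \<le> t" "t \<le> \<gamma>" for s t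
    by (rule ratio_mono[OF z1 Q1 Q_E_left(1), where c = \<gamma>])
      (use that monotone_onD[OF z2] \<gamma> less_imp_le[OF pos(2)] in auto)
  show "x \<in> {-1..\<gamma>} \<Longrightarrow> z1 \<gamma> * Q x \<le> z1 x * Q \<gamma>"
    using r[of x \<gamma>] by auto
  show "x \<in> {-1..\<gamma>} \<Longrightarrow> w \<gamma> * E x \<le> w x * E \<gamma>"
    by (rule ratio_mono[OF w E_slope Q_E_left(2), where c = \<gamma>])
      (use r \<gamma> less_imp_le[OF pos(1)] in auto)
  have s: "has_slope (\<lambda>x. Q \<gamma> * w x + - z1 \<gamma> * E x)
      (\<lambda>x. Q \<gamma> * (k1 x * z1 x) + - z1 \<gamma> * (k1 x * Q x))"
    by (intro has_slope_add has_slope_cmult w E_slope)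
  have nn: "0 \<le> Q \<gamma> * (k1 x * z1 x) + - z1 \<gamma> * (k1 x * Q x)" if "-1 \<le> x" "x \<le> \<gamma>" for x
  proof -
    have "0 \<le> k1 x * (z1 x * Q \<gamma> - z1 \<gamma> * Q x)"
      using r[of x \<gamma>] pos(1)[of x] that \<gamma> by (intro mult_nonneg_nonneg) auto
    then show ?thesis by (simp add: algebra_simps)
  qed
  have "0 \<le> Q \<gamma> * w \<gamma> + - z1 \<gamma> * E \<gamma>"
    using has_slope_mono[OF s, of "-1" \<gamma>, OF _ _ _ nn] \<gamma> w(2) Q_E_left by simp
  then show "z1 \<gamma> * E \<gamma> \<le> w \<gamma> * Q \<gamma>" by (simp add: algebra_simps)
qed

text \<open>
  Replacing \<open>z\<^sub>2\<close> by the constant \<open>K\<close> can only increase the two integrals.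
\<close>

lemma left_upper:
  assumes w: "has_slope w (\<lambda>x. k1 x * z1 x)" "w (-1) = 0"
    and z1: "has_slope z1 (\<lambda>x. k2 x * z2 x)" "z1 (-1) = 0"
    and z2: "\<And>x. x \<in> Ibar \<Longrightarrow> z2 x \<le> K"
    and x: "x \<in> Ibar"
  shows "w x \<le> K * E x"
proof -
  have s1: "has_slope (\<lambda>x. K * Q x + -1 * z1 x) (\<lambda>x. K * k2 x + -1 * (k2 x * z2 x))"
    by (intro has_slope_add has_slope_cmult Q_slope z1)
  have "z1 t \<le> K * Q t" if t: "t \<in> Ibar" for t
  proof -
    have nn: "0 \<le> K * k2 s + -1 * (k2 s * z2 s)" if "-1 \<le> s" "s \<le> t" for s
    proof -
      have "0 \<le> k2 s * (K - z2 s)"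
        using z2[of s] pos(2)[of s] that t by (intro mult_nonneg_nonneg) auto
      then show ?thesis by (simp add: algebra_simps)
    qed
    show ?thesis using has_slope_mono[OF s1, of "-1" t, OF _ _ _ nn] t Q_E_left z1(2) by simp
  qed
  note z1_le = this
  have s: "has_slope (\<lambda>x. K * E x + -1 * w x) (\<lambda>x. K * (k1 x * Q x) + -1 * (k1 x * z1 x))"
    by (intro has_slope_add has_slope_cmult E_slope w)
  have nn: "0 \<le> K * (k1 s * Q s) + -1 * (k1 s * z1 s)" if "-1 \<le> s" "s \<le> x" for s
  proof -
    have "0 \<le> k1 s * (K * Q s - z1 s)"
      using z1_le[of s] pos(1)[of s] that x by (intro mult_nonneg_nonneg) auto
    then show ?thesis by (simp add: algebra_simps)
  qed
  show ?thesis using has_slope_mono[OF s, of "-1" x, OF _ _ _ nn] x Q_E_left w(2) by simp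
qed

end

text \<open>
  Under \<open>x \<mapsto> -x\<close> the chain keeps its form when \<open>z\<^sub>1\<close> and \<open>z\<^sub>3\<close> change sign. The statements about the
  right end point are obtained in this way from those about the left one.
\<close>

lemma positive_chain_reflect:
  "positive_chain k1 k2 k3 \<Longrightarrow>
    positive_chain (\<lambda>x. k1 (- x)) (\<lambda>x. k2 (- x)) (\<lambda>x. k3 (- x))"
  unfolding positive_chain_def
  by (auto intro!: continuous_on_compose2[of Ibar _ Ibar uminus] continuous_intros)

context positive_chain
begin

lemma reflected: "positive_chain (\<lambda>x. k1 (- x)) (\<lambda>x. k2 (- x)) (\<lambda>x. k3 (- x))"
  by (rule positive_chain_reflect, unfold_locales)

text \<open>
  The counterparts of \<open>Q\<close> and \<open>E\<close> that start from zero at the right end point.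
\<close>

definition Qr :: "real \<Rightarrow> real" where
  "Qr x = positive_chain.Q (\<lambda>x. k2 (- x)) (- x)"
definition Er :: "real \<Rightarrow> real" where
  "Er x = positive_chain.E (\<lambda>x. k1 (- x)) (\<lambda>x. k2 (- x)) (- x)"

lemma reflect_slopes:
  assumes "clamped w z1 z2 z3 h"
  shows "has_slope (\<lambda>x. w (- x)) (\<lambda>x. k1 (- x) * - z1 (- x))"
    "has_slope (\<lambda>x. - z1 (- x)) (\<lambda>x. k2 (- x) * z2 (- x))"
proof -
  have "has_slope (\<lambda>x. w (- x)) (\<lambda>x. - (k1 (- x) * z1 (- x)))"
    using assms has_slope_reflect unfolding clamped_def by blast
  then show "has_slope (\<lambda>x. w (- x)) (\<lambda>x. k1 (- x) * - z1 (- x))" by simp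
  have "has_slope (\<lambda>x. z1 (- x)) (\<lambda>x. - (k2 (- x) * z2 (- x)))"
    using assms has_slope_reflect unfolding clamped_def by blast
  from has_slope_cmult[OF this, of "-1"]
  show "has_slope (\<lambda>x. - z1 (- x)) (\<lambda>x. k2 (- x) * z2 (- x))" by simp
qed

lemma right_half:
  assumes c: "clamped w z1 z2 z3 h"
    and z2: "mono_on {\<gamma>..1} z2"
    and \<gamma>: "\<gamma> \<in> Ibar"
  shows "x \<in> {\<gamma>..1} \<Longrightarrow> z1 x * Qr \<gamma> \<le> z1 \<gamma> * Qr x"
    and "x \<in> {\<gamma>..1} \<Longrightarrow> w \<gamma> * Er x \<le> w x * Er \<gamma>"
    and "- z1 \<gamma> * Er \<gamma> \<le> w \<gamma> * Qr \<gamma>"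
proof -
  interpret r: positive_chain "\<lambda>x. k1 (- x)" "\<lambda>x. k2 (- x)" "\<lambda>x. k3 (- x)"
    by (rule reflected)
  have b: "w (- (-1)) = 0" "- z1 (- (-1)) = 0" using c by (simp_all add: clamped_def)
  have z2': "antimono_on {-1..- \<gamma>} (\<lambda>x. z2 (- x))"
    using z2 by (auto simp: monotone_on_def)
  have \<gamma>': "- \<gamma> \<in> Ibar" using \<gamma> by auto
  note R = r.left_half[OF reflect_slopes(1)[OF c] b(1) reflect_slopes(2)[OF c] b(2) z2' \<gamma>']
  show "x \<in> {\<gamma>..1} \<Longrightarrow> z1 x * Qr \<gamma> \<le> z1 \<gamma> * Qr x"
    using R(1)[of "- x"] by (simp add: Qr_def)
  show "x \<in> {\<gamma>..1} \<Longrightarrow> w \<gamma> * Er x \<le> w x * Er \<gamma>"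
    using R(2)[of "- x"] by (simp add: Er_def)
  show "- z1 \<gamma> * Er \<gamma> \<le> w \<gamma> * Qr \<gamma>"
    using R(3) by (simp add: Er_def Qr_def)
qed

lemma reflected_pos:
  "x \<in> {-1..<1} \<Longrightarrow> 0 < Qr x" "x \<in> {-1..<1} \<Longrightarrow> 0 < Er x" "x \<in> Ibar \<Longrightarrow> 0 \<le> Er x"
proof -
  interpret r: positive_chain "\<lambda>x. k1 (- x)" "\<lambda>x. k2 (- x)" "\<lambda>x. k3 (- x)"
    by (rule reflected)
  show "x \<in> {-1..<1} \<Longrightarrow> 0 < Qr x" "x \<in> {-1..<1} \<Longrightarrow> 0 < Er x" "x \<in> Ibar \<Longrightarrow> 0 \<le> Er x"
    using r.Q_pos[of "- x"] r.E_pos[of "- x"] r.Q_E_left r.E_nonneg[of "- x"]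
    by (auto simp: Qr_def Er_def)
qed

text \<open>
  The model profile of a clamped solution. It vanishes quadratically at both ends, like
  \<open>(1 - x\<^sup>2)\<^sup>2\<close>, and every clamped solution with nonnegative data \<open>h \<noteq> 0\<close> is comparable to it from
  above and from below.
\<close>

definition envelope :: "real \<Rightarrow> real" where "envelope x = min (E x) (Er x)"

lemma envelope_pos: "x \<in> {-1<..<1} \<Longrightarrow> 0 < envelope x"
  using E_pos[of x] reflected_pos(2)[of x] by (auto simp: envelope_def)

lemma envelope_nonneg: "x \<in> Ibar \<Longrightarrow> 0 \<le> envelope x"
  using E_nonneg[of x] reflected_pos(3)[of x] by (auto simp: envelope_def)

lemma clamped_upper:
  assumes c: "clamped w z1 z2 z3 h" and K: "\<And>x. x \<in> Ibar \<Longrightarrow> z2 x \<le> K" "0 \<le> K" and x: "x \<in> Ibar"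
  shows "w x \<le> K * envelope x"
proof -
  interpret r: positive_chain "\<lambda>x. k1 (- x)" "\<lambda>x. k2 (- x)" "\<lambda>x. k3 (- x)"
    by (rule reflected)
  have "w x \<le> K * E x"
    by (rule left_upper[of w z1 z2]) (use c K x in \<open>auto simp: clamped_def\<close>)
  moreover have "w (- (- x)) \<le> K * r.E (- x)"
    by (rule r.left_upper[OF reflect_slopes(1)[OF c] _ reflect_slopes(2)[OF c]])
      (use c K x in \<open>auto simp: clamped_def\<close>)
  ultimately show ?thesis
    by (simp add: envelope_def Er_def min_def)
qed

lemma clamped_zero:
  assumes c: "clamped w z1 z2 z3 h" and z: "\<And>x. x \<in> Ibar \<Longrightarrow> w x = 0" and x: "x \<in> Ibar"
  shows "z1 x = 0" "z2 x = 0" "z3 x = 0" "h x = 0"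
proof -
  have 1: "z1 x = 0" if "x \<in> Ibar" for x
    using has_slope_zero[of w "\<lambda>x. k1 x * z1 x" x] z c pos(1)[of x] that by (auto simp: clamped_def)
  have 2: "z2 x = 0" if "x \<in> Ibar" for x
    using has_slope_zero[of z1 "\<lambda>x. k2 x * z2 x" x] 1 c pos(2)[of x] that by (auto simp: clamped_def)
  have 3: "z3 x = 0" if "x \<in> Ibar" for x
    using has_slope_zero[of z2 "\<lambda>x. k3 x * z3 x" x] 2 c pos(3)[of x] that by (auto simp: clamped_def)
  show "z1 x = 0" "z2 x = 0" "z3 x = 0" "h x = 0"
    using 1 2 3 has_slope_zero[of z3 h x] c x by (auto simp: clamped_def)
qed

text \<open>
  The core of the positivity argument. At the sign change \<open>\<gamma>\<close> of \<open>z\<^sub>3\<close> the left half gives \<open>w \<gamma> \<ge> 0\<close>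
  if \<open>z\<^sub>1 \<gamma> \<ge> 0\<close>, and the right half gives \<open>w \<gamma> > 0\<close> if \<open>z\<^sub>1 \<gamma> < 0\<close>. If \<open>w \<gamma> = 0\<close>, then \<open>z\<^sub>1 \<gamma> = 0\<close>, so \<open>z\<^sub>1\<close> is
  nonnegative before \<open>\<gamma>\<close> and nonpositive after it; thus \<open>w\<close> rises up to \<open>\<gamma>\<close> and falls after it while
  it vanishes at \<open>\<gamma>\<close> and at both ends, which forces \<open>w = 0\<close>.
\<close>

lemma clamped_pivot:
  assumes c: "clamped w z1 z2 z3 h" and h: "\<forall>x\<in>Ibar. 0 \<le> h x"
  shows "\<exists>\<gamma>\<in>Ibar. 0 \<le> w \<gamma> \<and>
    (\<forall>x\<in>{-1..\<gamma>}. w \<gamma> * E x \<le> w x * E \<gamma>) \<and>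
    (\<forall>x\<in>{\<gamma>..1}. w \<gamma> * Er x \<le> w x * Er \<gamma>) \<and>
    (w \<gamma> = 0 \<longrightarrow> (\<forall>x\<in>Ibar. w x = 0))"
proof -
  have sl: "has_slope w (\<lambda>x. k1 x * z1 x)" "has_slope z1 (\<lambda>x. k2 x * z2 x)"
    "has_slope z2 (\<lambda>x. k3 x * z3 x)" "has_slope z3 h"
    and b: "w (-1) = 0" "w 1 = 0" "z1 (-1) = 0" "z1 1 = 0"
    using c by (auto simp: clamped_def)
  obtain \<gamma> where \<gamma>: "\<gamma> \<in> Ibar" and left: "\<gamma> = -1 \<or> (\<forall>x\<in>{-1..\<gamma>}. z3 x \<le> 0)"
    and right: "\<gamma> = 1 \<or> (\<forall>x\<in>{\<gamma>..1}. 0 \<le> z3 x)"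
    by (rule has_slope_sign_change[OF sl(4) bspec[OF h]])
  have dec: "z2 t \<le> z2 s" if "-1 \<le> s" "s \<le> t" "t \<le> \<gamma>" for s t
  proof (cases "\<gamma> = -1")
    case True
    with that have "s = t" by simp
    then show ?thesis by simp
  next
    case False
    with left have l: "\<forall>x\<in>{-1..\<gamma>}. z3 x \<le> 0" by blast
    show ?thesis
    proof (rule has_slope_antimono[OF sl(3)])
      fix x assume "s \<le> x" "x \<le> t"
      then show "k3 x * z3 x \<le> 0"
        using l pos(3)[of x] that \<gamma> by (intro mult_nonneg_nonpos) auto
    qed (use that \<gamma> in auto)
  qed
  have inc: "z2 s \<le> z2 t" if "\<gamma> \<le> s" "s \<le> t" "t \<le> 1" for s t
  proof (cases "\<gamma> = 1")
    case True
    with that have "s = t" by simp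
    then show ?thesis by simp
  next
    case False
    with right have r: "\<forall>x\<in>{\<gamma>..1}. 0 \<le> z3 x" by blast
    show ?thesis
    proof (rule has_slope_mono[OF sl(3)])
      fix x assume "s \<le> x" "x \<le> t"
      then show "0 \<le> k3 x * z3 x"
        using r pos(3)[of x] that \<gamma> by (intro mult_nonneg_nonneg) auto
    qed (use that \<gamma> in auto)
  qed
  have dec': "antimono_on {-1..\<gamma>} z2" and inc': "mono_on {\<gamma>..1} z2"
    using dec inc by (auto simp: monotone_on_def)
  note Lh = left_half[OF sl(1) b(1) sl(2) b(3) dec' \<gamma>]
  note Rh = right_half[OF c inc' \<gamma>]
  have inner: "0 \<le> w \<gamma> \<and> (w \<gamma> = 0 \<longrightarrow> z1 \<gamma> = 0)"
  proof (cases "\<gamma> = -1 \<or> \<gamma> = 1")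
    case True
    then show ?thesis using b by auto
  next
    case False
    then have i: "\<gamma> \<in> {-1<..<1}" using \<gamma> by auto
    have p: "0 < Q \<gamma>" "0 < E \<gamma>" "0 < Qr \<gamma>" "0 < Er \<gamma>"
      using Q_pos[of \<gamma>] E_pos[of \<gamma>] reflected_pos(1,2)[of \<gamma>] i by auto
    show ?thesis
    proof (cases "0 \<le> z1 \<gamma>")
      case True
      then have "0 \<le> z1 \<gamma> * E \<gamma>" using p by simp
      with Lh(3) have "0 \<le> w \<gamma> * Q \<gamma>" by linarith
      with p have "0 \<le> w \<gamma>" by (simp add: zero_le_mult_iff)
      moreover have "z1 \<gamma> = 0" if "w \<gamma> = 0"
        using Lh(3) that p True by (simp add: mult_le_0_iff)
      ultimately show ?thesis by blast
    next
      case False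
      then have "0 < - z1 \<gamma> * Er \<gamma>" using p by (intro mult_pos_pos) auto
      with Rh(3) have "0 < w \<gamma> * Qr \<gamma>" by linarith
      with p have "0 < w \<gamma>" by (simp add: zero_less_mult_iff)
      then show ?thesis by auto
    qed
  qed
  have zero: "w x = 0" if w0: "w \<gamma> = 0" and x: "x \<in> Ibar" for x
  proof -
    have z0: "z1 \<gamma> = 0" using inner w0 by blast
    have l: "0 \<le> z1 t" if "t \<in> {-1..\<gamma>}" for t
    proof (cases "\<gamma> = -1")
      case True
      then show ?thesis using that b by auto
    next
      case False
      then show ?thesis using Lh(1)[OF that] z0 Q_pos[of \<gamma>] \<gamma> by (simp add: zero_le_mult_iff)
    qed
    have r: "z1 t \<le> 0" if "t \<in> {\<gamma>..1}" for t
    proof (cases "\<gamma> = 1")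
      case True
      then show ?thesis using that b by auto
    next
      case False
      then show ?thesis using Rh(1)[OF that] z0 reflected_pos(1)[of \<gamma>] \<gamma> by (simp add: mult_le_0_iff)
    qed
    have up: "w s \<le> w t" if "-1 \<le> s" "s \<le> t" "t \<le> \<gamma>" for s t
      by (rule has_slope_mono[OF sl(1)])
        (use that \<gamma> mult_nonneg_nonneg[OF less_imp_le[OF pos(1)] l] in simp_all)
    have down: "w t \<le> w s" if "\<gamma> \<le> s" "s \<le> t" "t \<le> 1" for s t
      by (rule has_slope_antimono[OF sl(1)])
        (use that \<gamma> mult_nonneg_nonpos[OF less_imp_le[OF pos(1)] r] in simp_all)
    show ?thesis
    proof (cases "x \<le> \<gamma>")
      case True
      then show ?thesis using up[of "-1" x] up[of x \<gamma>] w0 b x by auto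
    next
      case False
      then show ?thesis using down[of \<gamma> x] down[of x 1] w0 b x by auto
    qed
  qed
  show ?thesis
    by (rule bexI[OF _ \<gamma>], intro conjI ballI impI) (simp_all add: inner zero Lh(2) Rh(2))
qed

lemma clamped_nonneg:
  assumes c: "clamped w z1 z2 z3 h" and h: "\<And>x. x \<in> Ibar \<Longrightarrow> 0 \<le> h x" and x: "x \<in> Ibar"
  shows "0 \<le> w x"
proof -
  obtain \<gamma> where \<gamma>: "\<gamma> \<in> Ibar" "0 \<le> w \<gamma>"
    and l: "\<forall>x\<in>{-1..\<gamma>}. w \<gamma> * E x \<le> w x * E \<gamma>"
    and r: "\<forall>x\<in>{\<gamma>..1}. w \<gamma> * Er x \<le> w x * Er \<gamma>"
    using clamped_pivot[OF c ballI[OF h]] by blast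
  have b: "w (-1) = 0" "w 1 = 0" using c by (auto simp: clamped_def)
  show ?thesis
  proof (cases "x \<le> \<gamma>")
    case True
    show ?thesis
    proof (cases "\<gamma> = -1")
      case False
      have "0 \<le> w \<gamma> * E x" using \<gamma> E_nonneg[OF x] by simp
      then have "0 \<le> w x * E \<gamma>" using bspec[OF l, of x] True x by simp
      then show ?thesis using E_pos[of \<gamma>] False \<gamma> by (auto simp: zero_le_mult_iff)
    qed (use True x b in auto)
  next
    case F: False
    have "0 \<le> w \<gamma> * Er x" using \<gamma> reflected_pos(3)[OF x] by simp
    then have "0 \<le> w x * Er \<gamma>" using bspec[OF r, of x] F x by simp
    then show ?thesis using reflected_pos(2)[of \<gamma>] F \<gamma> x by (auto simp: zero_le_mult_iff)
  qed
qed

text \<open>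
  A Hopf-type boundary estimate: \<open>w \<gamma> > 0\<close> and the boundary values put the pivot \<open>\<gamma>\<close> in the open
  interval, and the monotone quotients \<open>w / E\<close> and \<open>w / Er\<close> transport this positive value to all other
  points.
\<close>

lemma clamped_lower:
  assumes c: "clamped w z1 z2 z3 h" and h: "\<And>x. x \<in> Ibar \<Longrightarrow> 0 \<le> h x"
    and nz: "y \<in> Ibar" "h y \<noteq> 0"
  obtains \<delta> where "0 < \<delta>" "\<And>x. x \<in> Ibar \<Longrightarrow> \<delta> * envelope x \<le> w x"
proof -
  obtain \<gamma> where \<gamma>: "\<gamma> \<in> Ibar" "0 \<le> w \<gamma>"
    and l: "\<forall>x\<in>{-1..\<gamma>}. w \<gamma> * E x \<le> w x * E \<gamma>"
    and r: "\<forall>x\<in>{\<gamma>..1}. w \<gamma> * Er x \<le> w x * Er \<gamma>"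
    and z: "w \<gamma> = 0 \<longrightarrow> (\<forall>x\<in>Ibar. w x = 0)"
    using clamped_pivot[OF c ballI[OF h]] by blast
  have b: "w (-1) = 0" "w 1 = 0" using c by (auto simp: clamped_def)
  have "w \<gamma> \<noteq> 0" using clamped_zero(4)[OF c _ nz(1)] z nz(2) by blast
  then have w: "0 < w \<gamma>" using \<gamma> by simp
  then have i: "\<gamma> \<in> {-1<..<1}" using b \<gamma> by (metis atLeastAtMost_iff greaterThanLessThan_iff less_eq_real_def less_irrefl)
  have p: "0 < E \<gamma>" "0 < Er \<gamma>"
    using E_pos[of \<gamma>] reflected_pos(2)[of \<gamma>] i by auto
  define \<delta> where "\<delta> = min (w \<gamma> / E \<gamma>) (w \<gamma> / Er \<gamma>)"
  show thesis
  proof (rule that[of \<delta>])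
    show "0 < \<delta>" using w p by (simp add: \<delta>_def)
    fix x assume x: "x \<in> Ibar"
    show "\<delta> * envelope x \<le> w x"
    proof (cases "x \<le> \<gamma>")
      case True
      have "\<delta> * envelope x \<le> (w \<gamma> / E \<gamma>) * E x"
        using w p E_nonneg[OF x] envelope_nonneg[OF x] by (intro mult_mono) (auto simp: \<delta>_def envelope_def)
      also have "\<dots> \<le> w x" using bspec[OF l, of x] True x p by (simp add: field_simps)
      finally show ?thesis .
    next
      case False
      have "\<delta> * envelope x \<le> (w \<gamma> / Er \<gamma>) * Er x"
        using w p reflected_pos(3)[OF x] envelope_nonneg[OF x] by (intro mult_mono) (auto simp: \<delta>_def envelope_def)
      also have "\<dots> \<le> w x" using bspec[OF r, of x] False x p by (simp add: field_simps)
      finally show ?thesis .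
    qed
  qed
qed

end

section \<open>A Krein-Rutman theorem\<close>

text \<open>
  \<open>T_dominates\<close> is strong positivity in a form that mentions no cone interior: the image of a
  nonnegative \<open>f \<noteq> 0\<close> is bounded below by a positive multiple of any other image \<open>T g\<close>. Linearity is
  condensed into one axiom, and all properties refer to values on the closed interval only.
\<close>

locale strongly_positive_compact =
  fixes T :: "(real \<Rightarrow> real) \<Rightarrow> real \<Rightarrow> real"
  assumes T_cont: "\<And>f. continuous_on Ibar f \<Longrightarrow> continuous_on Ibar (T f)"
    and T_add: "\<And>f g c x. continuous_on Ibar f \<Longrightarrow> continuous_on Ibar g \<Longrightarrow> x \<in> Ibar \<Longrightarrow>
      T (\<lambda>x. f x + c * g x) x = T f x + c * T g x"
    and T_nonneg: "\<And>f x. continuous_on Ibar f \<Longrightarrow> \<forall>x\<in>Ibar. 0 \<le> f x \<Longrightarrow> x \<in> Ibar \<Longrightarrow> 0 \<le> T f x"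
    and T_dominates: "\<And>f g y. continuous_on Ibar f \<Longrightarrow> \<forall>x\<in>Ibar. 0 \<le> f x \<Longrightarrow> y \<in> Ibar \<Longrightarrow> f y \<noteq> 0 \<Longrightarrow>
      continuous_on Ibar g \<Longrightarrow> \<exists>\<epsilon>>0. \<forall>x\<in>Ibar. \<epsilon> * T g x \<le> T f x"
    and T_one: "\<exists>y\<in>Ibar. T (\<lambda>_. 1) y \<noteq> 0"
    and T_compact: "\<And>f. (\<And>n. continuous_on Ibar (f n)) \<Longrightarrow> (\<And>n x. x \<in> Ibar \<Longrightarrow> \<bar>f n x\<bar> \<le> 1) \<Longrightarrow>
      \<exists>g r. strict_mono (r :: nat \<Rightarrow> nat) \<and> continuous_on Ibar g \<and>
        uniform_limit Ibar (\<lambda>n. T (f (r n))) g sequentially"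
begin

lemma T_scale:
  assumes "continuous_on Ibar f" "x \<in> Ibar"
  shows "T (\<lambda>x. c * f x) x = c * T f x"
proof -
  have "T (\<lambda>x. 0 + 1 * 0) x = T (\<lambda>_. 0) x + 1 * T (\<lambda>_. 0) x"
    by (rule T_add) (use assms in auto)
  then have z: "T (\<lambda>_. 0) x = 0" by simp
  have "T (\<lambda>x. 0 + c * f x) x = T (\<lambda>_. 0) x + c * T f x"
    by (rule T_add) (use assms in auto)
  then show ?thesis using z by simp
qed

lemma T_mono:
  assumes f: "continuous_on Ibar f" and g: "continuous_on Ibar g"
    and le: "\<forall>x\<in>Ibar. f x \<le> g x" and x: "x \<in> Ibar"
  shows "T f x \<le> T g x"
proof -
  have "0 \<le> T (\<lambda>x. g x + (-1) * f x) x"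
    by (rule T_nonneg) (use le x in \<open>auto intro!: continuous_intros f g\<close>)
  also have "\<dots> = T g x + (-1) * T f x" by (rule T_add[OF g f x])
  finally show ?thesis by simp
qed

lemma T_cong:
  assumes "continuous_on Ibar f" "continuous_on Ibar g" "\<forall>x\<in>Ibar. f x = g x" "x \<in> Ibar"
  shows "T f x = T g x"
  using T_mono[of f g x] T_mono[of g f x] assms by auto

lemma T_abs_le:
  assumes f: "continuous_on Ibar f" and b: "\<forall>x\<in>Ibar. \<bar>f x\<bar> \<le> d" and x: "x \<in> Ibar"
  shows "\<bar>T f x\<bar> \<le> d * T (\<lambda>_. 1) x"
proof -
  have d: "T (\<lambda>_. d * 1) x = d * T (\<lambda>_. 1) x" for d by (rule T_scale) (use x in auto)
  have "T f x \<le> T (\<lambda>_. d * 1) x"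
    by (rule T_mono) (use f b x in auto)
  moreover have "T (\<lambda>_. - d * 1) x \<le> T f x"
    by (rule T_mono) (use f b x in \<open>auto simp: abs_le_iff\<close>)
  ultimately show ?thesis using d[of d] d[of "- d"] by (simp add: abs_le_iff)
qed

lemma T_limit:
  assumes f: "\<And>n. continuous_on Ibar (f n)" and g: "continuous_on Ibar g"
    and lim: "uniform_limit Ibar f g sequentially" and x: "x \<in> Ibar"
  shows "(\<lambda>n. T (f n) x) \<longlonglongrightarrow> T g x"
proof (rule LIMSEQ_I)
  fix r :: real assume r: "0 < r"
  define B where "B = T (\<lambda>_. 1) x"
  have B: "0 \<le> B" unfolding B_def by (rule T_nonneg) (use x in auto)
  define d where "d = r / (B + 1)"
  have d: "0 < d" using r B by (simp add: d_def)
  have "\<forall>\<^sub>F n in sequentially. \<forall>x\<in>Ibar. dist (f n x) (g x) < d"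
    using uniform_limitD[OF lim d] .
  then obtain N where N: "\<forall>n\<ge>N. \<forall>y\<in>Ibar. \<bar>f n y - g y\<bar> < d"
    unfolding eventually_sequentially dist_real_def by blast
  have "norm (T (f n) x - T g x) < r" if n: "n \<ge> N" for n
  proof -
    have "\<bar>T (\<lambda>x. f n x + (-1) * g x) x\<bar> \<le> d * B"
      unfolding B_def
    proof (rule T_abs_le[OF _ _ x])
      show "\<forall>x\<in>Ibar. \<bar>f n x + (-1) * g x\<bar> \<le> d"
        using N n by (auto intro: less_imp_le)
    qed (intro continuous_intros f g)
    also have "d * B < r" using r B by (simp add: d_def field_simps)
    finally show ?thesis using T_add[OF f[of n] g x, of "-1"] by simp
  qed
  then show "\<exists>N. \<forall>n\<ge>N. norm (T (f n) x - T g x) < r" by blast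
qed

text \<open>
  If \<open>T\<close> inverts a differential operator, then \<open>\<rho>\<close> is the reciprocal of its eigenvalue \<open>\<mu>\<close>. The zero
  function is included here.
\<close>

definition eigen :: "real \<Rightarrow> (real \<Rightarrow> real) \<Rightarrow> bool" where
  "eigen \<rho> f \<longleftrightarrow> continuous_on Ibar f \<and> (\<forall>x\<in>Ibar. T f x = \<rho> * f x)"

definition nonneg_nonzero :: "(real \<Rightarrow> real) \<Rightarrow> bool" where
  "nonneg_nonzero f \<longleftrightarrow> (\<forall>x\<in>Ibar. 0 \<le> f x) \<and> (\<exists>x\<in>Ibar. f x \<noteq> 0)"

lemma dominates:
  assumes "continuous_on Ibar f" "nonneg_nonzero f" "continuous_on Ibar g"
  shows "\<exists>\<epsilon>>0. \<forall>x\<in>Ibar. \<epsilon> * T g x \<le> T f x"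
  using T_dominates assms unfolding nonneg_nonzero_def by blast

lemma T_one_nonneg: "x \<in> Ibar \<Longrightarrow> 0 \<le> T (\<lambda>_. 1) x"
  by (rule T_nonneg) auto

lemma eigenvalue_pos:
  assumes f: "eigen \<rho> f" "nonneg_nonzero f"
  shows "0 < \<rho>"
proof -
  obtain y where y: "y \<in> Ibar" "T (\<lambda>_. 1) y \<noteq> 0" using T_one by blast
  obtain \<epsilon> where \<epsilon>: "0 < \<epsilon>" "\<forall>x\<in>Ibar. \<epsilon> * T (\<lambda>_. 1) x \<le> T f x"
    using dominates[OF _ f(2) continuous_on_const] f(1) unfolding eigen_def by blast
  have "0 < \<epsilon> * T (\<lambda>_. 1) y" using \<epsilon> y T_one_nonneg[of y] by simp
  also have "\<dots> \<le> T f y" using \<epsilon>(2) y(1) by blast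
  also have "\<dots> = \<rho> * f y" using f(1) y(1) unfolding eigen_def by blast
  finally have "0 < \<rho> * f y" .
  moreover have "0 \<le> f y" using f(2) y(1) unfolding nonneg_nonzero_def by blast
  ultimately show ?thesis by (simp add: zero_less_mult_iff)
qed

text \<open>
  Touching argument: let \<open>k\<close> be the largest number with \<open>k g \<le> f\<close>. If \<open>h = f - k g\<close> is not zero, then
  \<open>T h \<ge> \<epsilon> T g\<close> for some \<open>\<epsilon> > 0\<close>. On the other hand \<open>T h = \<rho> f - k \<rho>' g \<le> \<rho> (f - k g)\<close>, where \<open>\<rho> \<le> \<rho>'\<close>
  is used, so \<open>f \<ge> (k + \<epsilon> \<rho>' / \<rho>) g\<close> contradicts the choice of \<open>k\<close>.
\<close>

lemma eigenfunctions_proportional: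
  assumes f: "eigen \<rho> f" "nonneg_nonzero f" and g: "eigen \<rho>' g" "nonneg_nonzero g"
    and le: "\<rho> \<le> \<rho>'"
  obtains k where "\<forall>x\<in>Ibar. f x = k * g x"
proof -
  have \<rho>: "0 < \<rho>" "0 < \<rho>'" using eigenvalue_pos f g by auto
  have fc: "continuous_on Ibar f" and gc: "continuous_on Ibar g"
    and fe: "\<And>x. x \<in> Ibar \<Longrightarrow> T f x = \<rho> * f x" and ge: "\<And>x. x \<in> Ibar \<Longrightarrow> T g x = \<rho>' * g x"
    and fn: "\<And>x. x \<in> Ibar \<Longrightarrow> 0 \<le> f x" and gn: "\<And>x. x \<in> Ibar \<Longrightarrow> 0 \<le> g x"
    using f g by (auto simp: eigen_def nonneg_nonzero_def)
  obtain y where y: "y \<in> Ibar" "g y \<noteq> 0" using g by (auto simp: nonneg_nonzero_def)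
  then have gy: "0 < g y" using gn[of y] by simp
  define \<Delta> where "\<Delta> = {d. 0 \<le> d \<and> (\<forall>x\<in>Ibar. d * g x \<le> f x)}"
  have \<Delta>0: "0 \<in> \<Delta>" using fn by (simp add: \<Delta>_def)
  have "d \<le> f y / g y" if "d \<in> \<Delta>" for d
    using that y gy by (simp add: \<Delta>_def field_simps)
  then have bdd: "bdd_above \<Delta>" by (rule bdd_aboveI)
  define k where "k = Sup \<Delta>"
  have k0: "0 \<le> k" unfolding k_def by (rule cSup_upper[OF \<Delta>0 bdd])
  have kle: "k * g x \<le> f x" if x: "x \<in> Ibar" for x
  proof (cases "g x = 0")
    case False
    then have p: "0 < g x" using gn[OF x] by simp
    have "k \<le> f x / g x"
      unfolding k_def
      by (rule cSup_least) (use \<Delta>0 p x in \<open>auto simp: \<Delta>_def field_simps\<close>)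
    then show ?thesis using p by (simp add: field_simps)
  qed (use fn x in simp)
  define h where "h x = f x + - k * g x" for x
  have hc: "continuous_on Ibar h" unfolding h_def by (intro continuous_intros fc gc)
  have "h x = 0" if x: "x \<in> Ibar" for x
  proof (rule ccontr)
    assume "h x \<noteq> 0"
    then have "nonneg_nonzero h" using x kle by (auto simp: nonneg_nonzero_def h_def)
    then obtain \<epsilon> where \<epsilon>: "0 < \<epsilon>" "\<forall>x\<in>Ibar. \<epsilon> * T g x \<le> T h x"
      using dominates[OF hc _ gc] by blast
    define d where "d = k + \<epsilon> * \<rho>' / \<rho>"
    have "d * g x \<le> f x" if x: "x \<in> Ibar" for x
    proof -
      have "T h x = \<rho> * f x + - k * (\<rho>' * g x)"
        using T_add[OF fc gc x, of "- k"] fe[OF x] ge[OF x] by (simp add: h_def[abs_def])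
      moreover have "\<epsilon> * (\<rho>' * g x) \<le> T h x" using \<epsilon>(2) x ge by metis
      moreover have "k * (\<rho> * g x) \<le> k * (\<rho>' * g x)"
        using le k0 gn[OF x] by (intro mult_left_mono mult_right_mono)
      ultimately have "\<epsilon> * (\<rho>' * g x) + k * (\<rho> * g x) \<le> \<rho> * f x" by simp
      then show ?thesis using \<rho> by (simp add: d_def field_simps)
    qed
    moreover have kd: "k < d" using \<epsilon> \<rho> by (simp add: d_def)
    ultimately have "d \<in> \<Delta>" using k0 by (simp add: \<Delta>_def)
    then have "d \<le> k" unfolding k_def by (rule cSup_upper[OF _ bdd])
    then show False using kd by simp
  qed
  then show thesis using that[of k] by (simp add: h_def)
qed

lemma positive_eigenvalue_unique:
  assumes f: "eigen \<rho> f" "nonneg_nonzero f" and g: "eigen \<rho>' g" "nonneg_nonzero g"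
  shows "\<rho> = \<rho>'"
proof -
  have wlog: "\<rho> = \<rho>'" if f: "eigen \<rho> f" "nonneg_nonzero f" and g: "eigen \<rho>' g" "nonneg_nonzero g"
    and le: "\<rho> \<le> \<rho>'" for \<rho> \<rho>' f g
  proof -
    obtain k where k: "\<forall>x\<in>Ibar. f x = k * g x"
      by (rule eigenfunctions_proportional[OF f g le])
    obtain y where y: "y \<in> Ibar" "f y \<noteq> 0" using f by (auto simp: nonneg_nonzero_def)
    have gc: "continuous_on Ibar g" using g by (simp add: eigen_def)
    have "T f y = T (\<lambda>x. k * g x) y"
      by (rule T_cong) (use f k y in \<open>auto simp: eigen_def intro!: continuous_intros gc\<close>)
    also have "\<dots> = \<rho>' * (k * g y)"
      using T_scale[OF gc y(1)] g y by (simp add: eigen_def)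
    finally have "\<rho> * f y = \<rho>' * f y" using f k y by (simp add: eigen_def)
    then show ?thesis using y by simp
  qed
  show ?thesis using wlog[OF f g] wlog[OF g f] by linarith
qed

text \<open>
  Domination provides \<open>\<epsilon> > 0\<close> with \<open>\<epsilon> \<phi> \<le> g\<close>, so \<open>g - \<epsilon> \<phi>\<close> is a nonnegative eigenfunction for the same
  eigenvalue, or zero, even if \<open>\<phi>\<close> changes sign; hence it is a multiple of \<open>g\<close>.
\<close>

lemma positive_eigenvalue_simple:
  assumes g: "eigen \<rho> g" "nonneg_nonzero g" and \<phi>: "eigen \<rho> \<phi>"
  obtains k where "\<forall>x\<in>Ibar. \<phi> x = k * g x"
proof -
  have \<rho>: "0 < \<rho>" by (rule eigenvalue_pos[OF g])
  have gc: "continuous_on Ibar g" and \<phi>c: "continuous_on Ibar \<phi>"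
    and ge: "\<And>x. x \<in> Ibar \<Longrightarrow> T g x = \<rho> * g x" and \<phi>e: "\<And>x. x \<in> Ibar \<Longrightarrow> T \<phi> x = \<rho> * \<phi> x"
    using g \<phi> by (auto simp: eigen_def)
  obtain \<epsilon> where \<epsilon>: "0 < \<epsilon>" "\<forall>x\<in>Ibar. \<epsilon> * T \<phi> x \<le> T g x"
    using dominates[OF gc g(2) \<phi>c] by blast
  define f where "f x = g x + - \<epsilon> * \<phi> x" for x
  have fc: "continuous_on Ibar f" unfolding f_def by (intro continuous_intros gc \<phi>c)
  have fn: "0 \<le> f x" if x: "x \<in> Ibar" for x
  proof -
    have "\<epsilon> * (\<rho> * \<phi> x) \<le> \<rho> * g x" using \<epsilon>(2) x ge \<phi>e by metis
    then have "\<rho> * (\<epsilon> * \<phi> x) \<le> \<rho> * g x" by (simp add: mult_ac)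
    then show ?thesis using \<rho> by (simp add: f_def)
  qed
  obtain k where k: "\<forall>x\<in>Ibar. f x = k * g x"
  proof (cases "\<forall>x\<in>Ibar. f x = 0")
    case True
    then show ?thesis using that[of 0] by simp
  next
    case False
    then have "nonneg_nonzero f" using fn by (auto simp: nonneg_nonzero_def)
    moreover have "eigen \<rho> f"
      unfolding eigen_def
    proof (intro conjI ballI fc)
      fix x :: real assume x: "x \<in> Ibar"
      show "T f x = \<rho> * f x"
        using T_add[OF gc \<phi>c x, of "- \<epsilon>"] ge[OF x] \<phi>e[OF x]
        by (simp add: f_def[abs_def] algebra_simps)
    qed
    ultimately show ?thesis
      using eigenfunctions_proportional[OF _ _ g order_refl] that by blast
  qed
  have "\<phi> x = ((1 - k) / \<epsilon>) * g x" if "x \<in> Ibar" for x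
  proof -
    have "g x - \<epsilon> * \<phi> x = k * g x" using k that by (simp add: f_def)
    then show ?thesis using \<epsilon>(1) by (simp add: field_simps)
  qed
  then show thesis using that by blast
qed

text \<open>
  The lower Collatz-Wielandt numbers of \<open>T\<close>; their supremum will be the principal eigenvalue. The
  test functions have maximum 1, so that the compactness of \<open>T\<close> applies to sequences of them.
\<close>

definition admissible :: "real set" where
  "admissible = {l. 0 \<le> l \<and> (\<exists>u. continuous_on Ibar u \<and> (\<forall>x\<in>Ibar. 0 \<le> u x \<and> u x \<le> 1) \<and>
    (\<exists>x\<in>Ibar. u x = 1) \<and> (\<forall>x\<in>Ibar. l * u x \<le> T u x))}"

lemma admissibleI:
  assumes u: "continuous_on Ibar u" "nonneg_nonzero u" and l: "0 \<le> l"
    and le: "\<forall>x\<in>Ibar. l * u x \<le> T u x"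
  shows "l \<in> admissible"
proof -
  obtain y where y: "y \<in> Ibar" "\<forall>x\<in>Ibar. u x \<le> u y"
    using continuous_attains_sup[of Ibar u] u by auto
  obtain y' where y': "y' \<in> Ibar" "u y' \<noteq> 0" "0 \<le> u y'" using u by (auto simp: nonneg_nonzero_def)
  then have p: "0 < u y" using y by (smt (verit))
  define v where "v x = (1 / u y) * u x" for x
  have "continuous_on Ibar v" unfolding v_def by (intro continuous_intros u)
  moreover have "\<forall>x\<in>Ibar. 0 \<le> v x \<and> v x \<le> 1"
    using u y p by (auto simp: v_def nonneg_nonzero_def)
  moreover have "v y = 1" using p by (simp add: v_def)
  moreover have "l * v x \<le> T v x" if x: "x \<in> Ibar" for x
    using T_scale[OF u(1) x, of "1 / u y"] le x p by (simp add: v_def[abs_def] divide_right_mono)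
  ultimately show ?thesis unfolding admissible_def using l y by blast
qed

text \<open>
  Let \<open>\<rho>\<close> be the supremum of the admissible numbers and \<open>u n\<close> an almost optimal sequence. A subsequence
  of \<open>T (u n)\<close> converges uniformly to some \<open>g\<close>, and applying \<open>T\<close> to \<open>l n * u n \<le> T (u n)\<close> yields
  \<open>\<rho> g \<le> T g\<close> in the limit. If \<open>f = T g - \<rho> g\<close> were not zero, then
  \<open>T (T g) - \<rho> T g = T f \<ge> \<delta> T g\<close> would make \<open>\<rho> + \<delta>\<close> admissible, with \<open>T g\<close> as test function.
\<close>

theorem positive_eigenfunction_exists:
  obtains \<rho> g where "eigen \<rho> g" "nonneg_nonzero g"
proof -
  define w where "w = T (\<lambda>_. 1)"
  have wc: "continuous_on Ibar w" unfolding w_def by (intro T_cont continuous_on_const)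
  have wn: "nonneg_nonzero w"
    using T_one T_one_nonneg by (auto simp: nonneg_nonzero_def w_def)
  obtain \<epsilon> where \<epsilon>: "0 < \<epsilon>" "\<forall>x\<in>Ibar. \<epsilon> * w x \<le> T w x"
    using dominates[OF wc wn continuous_on_const[of Ibar 1]] unfolding w_def by blast
  have \<epsilon>in: "\<epsilon> \<in> admissible" by (rule admissibleI[OF wc wn _ \<epsilon>(2)]) (use \<epsilon> in simp)
  obtain B where B: "0 < B" "\<And>x. x \<in> Ibar \<Longrightarrow> \<bar>w x\<bar> \<le> B" by (rule continuous_bounded[OF wc]) auto
  have "l \<le> B" if "l \<in> admissible" for l
  proof -
    obtain u x where u: "continuous_on Ibar u" "\<forall>x\<in>Ibar. 0 \<le> u x \<and> u x \<le> 1"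
      "x \<in> Ibar" "u x = 1" "\<forall>x\<in>Ibar. l * u x \<le> T u x"
      using \<open>l \<in> admissible\<close> unfolding admissible_def by blast
    have "l \<le> T u x" using u by force
    also have "\<dots> \<le> w x" unfolding w_def by (rule T_mono) (use u in auto)
    also have "\<dots> \<le> B" using B(2)[OF u(3)] by simp
    finally show ?thesis .
  qed
  then have bdd: "bdd_above admissible" by (rule bdd_aboveI)
  define \<rho> where "\<rho> = Sup admissible"
  have \<rho>ub: "l \<le> \<rho>" if "l \<in> admissible" for l
    unfolding \<rho>_def by (rule cSup_upper[OF that bdd])
  have \<rho>: "0 < \<rho>" using \<rho>ub[OF \<epsilon>in] \<epsilon> by simp
  \<comment> \<open>The shift by 2 keeps all these numbers above \<open>\<rho> / 2\<close>.\<close>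
  have "\<exists>l\<in>admissible. \<rho> - \<rho> / (real n + 2) < l" for n
  proof -
    have "\<rho> - \<rho> / (real n + 2) < Sup admissible" using \<rho> by (simp add: \<rho>_def[symmetric])
    then show ?thesis using less_cSup_iff[OF _ bdd] \<epsilon>in by blast
  qed
  then have "\<forall>n. \<exists>l u. \<rho> - \<rho> / (real n + 2) < l \<and> l \<in> admissible \<and> continuous_on Ibar u \<and>
      (\<forall>x\<in>Ibar. 0 \<le> u x \<and> u x \<le> 1) \<and> (\<exists>x\<in>Ibar. u x = 1) \<and> (\<forall>x\<in>Ibar. l * u x \<le> T u x)"
    unfolding admissible_def by blast
  then obtain l u where lu: "\<And>n. \<rho> - \<rho> / (real n + 2) < l n" "\<And>n. l n \<in> admissible"
    and uc: "\<And>n. continuous_on Ibar (u n)"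
    and ub: "\<And>n. \<forall>x\<in>Ibar. 0 \<le> u n x \<and> u n x \<le> 1" and u1: "\<And>n. \<exists>x\<in>Ibar. u n x = 1"
    and ul: "\<And>n. \<forall>x\<in>Ibar. l n * u n x \<le> T (u n) x"
    by metis
  have llim: "l \<longlonglongrightarrow> \<rho>"
  proof (rule real_tendsto_sandwich)
    show "\<forall>\<^sub>F n in sequentially. \<rho> - \<rho> / (real n + 2) \<le> l n"
      using lu(1) by (auto intro!: always_eventually less_imp_le)
    show "\<forall>\<^sub>F n in sequentially. l n \<le> \<rho>"
      using lu(2) \<rho>ub by (auto intro!: always_eventually)
    have "(\<lambda>n. \<rho> - \<rho> / (real (n + 2))) \<longlonglongrightarrow> \<rho> - 0"
      by (intro tendsto_diff tendsto_const) (rule LIMSEQ_ignore_initial_segment[OF lim_const_over_n])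
    then show "(\<lambda>n. \<rho> - \<rho> / (real n + 2)) \<longlonglongrightarrow> \<rho>" by (simp add: add.commute)
  qed simp
  have "\<bar>u n x\<bar> \<le> 1" if "x \<in> Ibar" for n x using ub[of n] that by auto
  then obtain g r where r: "strict_mono (r :: nat \<Rightarrow> nat)" and gc: "continuous_on Ibar g"
    and lim: "uniform_limit Ibar (\<lambda>n. T (u (r n))) g sequentially"
    using T_compact[of u] uc by blast
  have Tuc: "continuous_on Ibar (T (u n))" for n by (rule T_cont[OF uc])
  have Tun: "0 \<le> T (u n) x" if "x \<in> Ibar" for n x
    by (rule T_nonneg[OF uc _ that]) (use ub in blast)
  have glim: "(\<lambda>n. T (u (r n)) x) \<longlonglongrightarrow> g x" if "x \<in> Ibar" for x
    by (rule tendsto_uniform_limitI[OF lim that])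
  have gn: "0 \<le> g x" if "x \<in> Ibar" for x
    by (rule LIMSEQ_le_const[OF glim[OF that]]) (use Tun that in blast)
  have gle: "\<rho> * g x \<le> T g x" if x: "x \<in> Ibar" for x
  proof (rule LIMSEQ_le)
    show "(\<lambda>n. l (r n) * T (u (r n)) x) \<longlonglongrightarrow> \<rho> * g x"
      by (intro tendsto_mult glim x) (rule LIMSEQ_subseq_LIMSEQ[OF llim r, unfolded o_def])
    show "(\<lambda>n. T (T (u (r n))) x) \<longlonglongrightarrow> T g x"
      by (rule T_limit[OF Tuc gc lim x])
    have "l n * T (u n) x \<le> T (T (u n)) x" for n
      using T_mono[OF continuous_on_mult[OF continuous_on_const uc] Tuc ul x]
        T_scale[OF uc x] by simp
    then show "\<exists>N. \<forall>n\<ge>N. l (r n) * T (u (r n)) x \<le> T (T (u (r n))) x" by blast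
  qed
  \<comment> \<open>The normalization prevents the limit from vanishing: \<open>u n\<close> has maximum 1, so \<open>T (u n)\<close> takes a
    value of at least \<open>l n\<close>, which stays above \<open>\<rho> / 2\<close>.\<close>
  have g0: "\<exists>x\<in>Ibar. g x \<noteq> 0"
  proof (rule ccontr)
    assume "\<not> ?thesis"
    then have z: "\<forall>x\<in>Ibar. g x = 0" by blast
    have "\<forall>\<^sub>F n in sequentially. \<forall>x\<in>Ibar. dist (T (u (r n)) x) (g x) < \<rho> / 2"
      by (rule uniform_limitD[OF lim half_gt_zero[OF \<rho>]])
    then obtain n where n: "\<forall>x\<in>Ibar. dist (T (u (r n)) x) (g x) < \<rho> / 2"
      unfolding eventually_sequentially by blast
    obtain x where x: "x \<in> Ibar" "u (r n) x = 1" using u1 by blast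
    have "\<rho> / (real (r n) + 2) \<le> \<rho> / 2" using \<rho> by (intro divide_left_mono) auto
    then have "\<rho> / 2 < l (r n)" using lu(1)[of "r n"] by simp
    moreover have "l (r n) \<le> T (u (r n)) x" using bspec[OF ul x(1), of "r n"] x(2) by simp
    moreover have "T (u (r n)) x < \<rho> / 2"
      using bspec[OF n x(1)] bspec[OF z x(1)] by (simp add: dist_real_def abs_less_iff)
    ultimately show False by linarith
  qed
  have gnn: "nonneg_nonzero g" using gn g0 by (auto simp: nonneg_nonzero_def)
  define f where "f x = T g x + - \<rho> * g x" for x
  have Tgc: "continuous_on Ibar (T g)" by (rule T_cont[OF gc])
  have fc: "continuous_on Ibar f" unfolding f_def by (intro continuous_intros gc Tgc)
  have "f x = 0" if x: "x \<in> Ibar" for x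
  proof (rule ccontr)
    assume "f x \<noteq> 0"
    then have "nonneg_nonzero f" using x gle by (auto simp: nonneg_nonzero_def f_def)
    then obtain \<delta> where \<delta>: "0 < \<delta>" "\<forall>x\<in>Ibar. \<delta> * T g x \<le> T f x"
      using dominates[OF fc _ gc] by blast
    obtain y where y: "y \<in> Ibar" "g y \<noteq> 0" using g0 by blast
    have "0 < \<rho> * g y" using \<rho> gn[OF y(1)] y(2) by simp
    then have "T g y \<noteq> 0" using gle[OF y(1)] by simp
    then have Tg: "nonneg_nonzero (T g)"
      using y T_nonneg[OF gc] gn by (auto simp: nonneg_nonzero_def)
    have "(\<rho> + \<delta>) * T g x \<le> T (T g) x" if x: "x \<in> Ibar" for x
    proof -
      have "T f x = T (T g) x + - \<rho> * T g x"
        using T_add[OF Tgc gc x, of "- \<rho>"] by (simp add: f_def[abs_def])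
      then show ?thesis using bspec[OF \<delta>(2) x] by (simp add: algebra_simps)
    qed
    then have "\<rho> + \<delta> \<in> admissible"
      using \<rho> \<delta> by (intro admissibleI[OF Tgc Tg]) auto
    then show False using \<rho>ub[of "\<rho> + \<delta>"] \<delta> by simp
  qed
  then have "eigen \<rho> g" using gc by (simp add: eigen_def f_def)
  then show thesis using that gnn by blast
qed

end

section \<open>The solution operator of a clamped chain\<close>

lemma has_slope_lipschitz:
  assumes "has_slope f f'" "\<And>x. x \<in> Ibar \<Longrightarrow> \<bar>f' x\<bar> \<le> B" "x \<in> Ibar" "y \<in> Ibar"
  shows "\<bar>f x - f y\<bar> \<le> B * \<bar>x - y\<bar>"
  using field_differentiable_bound[of Ibar f f' B x y] assms
  by (auto simp: has_slope_def)

context positive_chain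
begin

lemma clamped_add:
  assumes "clamped w z1 z2 z3 h" "clamped w' z1' z2' z3' h'"
  shows "clamped (\<lambda>x. w x + c * w' x) (\<lambda>x. z1 x + c * z1' x) (\<lambda>x. z2 x + c * z2' x)
    (\<lambda>x. z3 x + c * z3' x) (\<lambda>x. h x + c * h' x)"
proof -
  have s: "has_slope (\<lambda>x. f x + c * g x) (\<lambda>x. k x * (f' x + c * g' x))"
    if "has_slope f (\<lambda>x. k x * f' x)" "has_slope g (\<lambda>x. k x * g' x)" for f f' g g' k
    by (rule has_slope_cong[OF has_slope_add[OF that(1) has_slope_cmult[OF that(2), of c]]])
      (simp_all add: algebra_simps)
  show ?thesis
    using assms unfolding clamped_def by (auto intro!: s has_slope_add has_slope_cmult)
qed

lemma clamped_unique:
  assumes w: "clamped w z1 z2 z3 h" and w': "clamped w' z1' z2' z3' h'"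
    and h: "\<And>x. x \<in> Ibar \<Longrightarrow> h x = h' x" and x: "x \<in> Ibar"
  shows "w x = w' x"
  using clamped_nonneg[OF clamped_add[OF w w', of "-1"] _ x]
    clamped_nonneg[OF clamped_add[OF w' w, of "-1"] _ x] h by simp

text \<open>
  Existence by superposition: integrating from the left end point leaves two constants \<open>\<alpha>\<close> and \<open>\<beta>\<close>, the
  initial values of \<open>z\<^sub>2\<close> and \<open>z\<^sub>3\<close>, to be chosen so that \<open>w\<close> and \<open>z\<^sub>1\<close> vanish at the right end point.
  The determinant of this linear system is not zero because the problem with \<open>h = 0\<close> has only the
  zero solution. Cramer's rule bounds the slope of \<open>w\<close> linearly in the bound of the data, and this
  slope bound is the source of compactness.
\<close>

lemma clamped_solvable:
  obtains C where "0 < C"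
    "\<And>f N. continuous_on Ibar f \<Longrightarrow> (\<And>x. x \<in> Ibar \<Longrightarrow> \<bar>f x\<bar> \<le> N) \<Longrightarrow>
      \<exists>w z1 z2 z3. clamped w z1 z2 z3 f \<and> (\<forall>x\<in>Ibar. \<bar>k1 x * z1 x\<bar> \<le> C * N)"
proof -
  define R where "R = prim k3"
  define S2 where "S2 = prim (\<lambda>x. k2 x * R x)"
  define S1 where "S1 = prim (\<lambda>x. k1 x * S2 x)"
  have Rs: "has_slope R k3" unfolding R_def by (rule prim_slope[OF cont(3)])
  have S2s: "has_slope S2 (\<lambda>x. k2 x * R x)"
    unfolding S2_def by (intro prim_slope continuous_on_mult cont has_slope_continuous[OF Rs])
  have S1s: "has_slope S1 (\<lambda>x. k1 x * S2 x)"
    unfolding S1_def by (intro prim_slope continuous_on_mult cont has_slope_continuous[OF S2s])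
  have left: "R (-1) = 0" "S2 (-1) = 0" "S1 (-1) = 0" by (simp_all add: R_def S2_def S1_def)
  define det where "det = Q 1 * S1 1 - E 1 * S2 1"
  \<comment> \<open>Otherwise the constants below solve the homogeneous system, and \<open>\<beta> \<noteq> 0\<close> since \<open>Q 1 > 0\<close>.\<close>
  have det: "det \<noteq> 0"
  proof
    assume d: "det = 0"
    define \<alpha> where "\<alpha> = S2 1"
    define \<beta> where "\<beta> = - Q 1"
    define w where "w x = \<alpha> * E x + \<beta> * S1 x" for x
    define z1 where "z1 x = \<alpha> * Q x + \<beta> * S2 x" for x
    define z2 where "z2 x = \<alpha> + \<beta> * R x" for x
    have "has_slope w (\<lambda>x. k1 x * z1 x)"
      by (rule has_slope_cong[OF has_slope_add[OF has_slope_cmult[OF E_slope, of \<alpha>]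
            has_slope_cmult[OF S1s, of \<beta>]]]) (simp_all add: w_def z1_def algebra_simps)
    moreover have "has_slope z1 (\<lambda>x. k2 x * z2 x)"
      by (rule has_slope_cong[OF has_slope_add[OF has_slope_cmult[OF Q_slope, of \<alpha>]
            has_slope_cmult[OF S2s, of \<beta>]]]) (simp_all add: z1_def z2_def algebra_simps)
    moreover have "has_slope z2 (\<lambda>x. k3 x * \<beta>)"
      by (rule has_slope_cong[OF has_slope_add[OF has_slope_const[of \<alpha>]
            has_slope_cmult[OF Rs, of \<beta>]]]) (simp_all add: z2_def algebra_simps)
    moreover have "z1 1 = 0" by (simp add: z1_def \<alpha>_def \<beta>_def)
    moreover have "w 1 = - det" by (simp add: w_def \<alpha>_def \<beta>_def det_def)
    ultimately have c: "clamped w z1 z2 (\<lambda>_. \<beta>) (\<lambda>_. 0)"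
      using d left Q_E_left
      by (simp add: clamped_def has_slope_const w_def z1_def)
    have "clamped (\<lambda>_. 0) (\<lambda>_. 0) (\<lambda>_. 0) (\<lambda>_. 0) (\<lambda>_. 0)"
      by (simp add: clamped_def has_slope_const)
    then have "w x = 0" if "x \<in> Ibar" for x
      using clamped_unique[OF c _ _ that] by blast
    then have "\<beta> = 0" using clamped_zero(3)[OF c, of 0] by simp
    then show False using Q_pos[of 1] by (simp add: \<beta>_def)
  qed
  obtain K1 where K1: "0 < K1" "\<And>x. x \<in> Ibar \<Longrightarrow> \<bar>k1 x\<bar> \<le> K1"
    by (rule continuous_bounded[OF cont(1)]) auto
  obtain K2 where K2: "0 < K2" "\<And>x. x \<in> Ibar \<Longrightarrow> \<bar>k2 x\<bar> \<le> K2"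
    by (rule continuous_bounded[OF cont(2)]) auto
  obtain K3 where K3: "0 < K3" "\<And>x. x \<in> Ibar \<Longrightarrow> \<bar>k3 x\<bar> \<le> K3"
    by (rule continuous_bounded[OF cont(3)]) auto
  obtain MQ where MQ: "0 < MQ" "\<And>x. x \<in> Ibar \<Longrightarrow> \<bar>Q x\<bar> \<le> MQ"
    by (rule continuous_bounded[OF has_slope_continuous[OF Q_slope]]) auto
  obtain MS where MS: "0 < MS" "\<And>x. x \<in> Ibar \<Longrightarrow> \<bar>S2 x\<bar> \<le> MS"
    by (rule continuous_bounded[OF has_slope_continuous[OF S2s]]) auto
  define G1 where "G1 = 2 * (K2 * (2 * (K3 * 2)))"
  define G0 where "G0 = 2 * (K1 * G1)"
  define Ca where "Ca = (\<bar>S2 1\<bar> * G0 + \<bar>S1 1\<bar> * G1) / \<bar>det\<bar>"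
  define Cb where "Cb = (\<bar>E 1\<bar> * G1 + \<bar>Q 1\<bar> * G0) / \<bar>det\<bar>"
  define C where "C = K1 * (G1 + (Ca * MQ + Cb * MS))"
  have G: "0 < G1" "0 < G0" using K1 K2 K3 by (simp_all add: G1_def G0_def)
  have Cab: "0 \<le> Ca" "0 \<le> Cb" using G by (simp_all add: Ca_def Cb_def)
  have C: "0 < C" using G Cab K1 MQ MS by (auto simp: C_def intro!: mult_pos_pos add_pos_nonneg)
  have bnd: "\<bar>prim (\<lambda>x. k x * g x) x\<bar> \<le> 2 * (K * B)"
    if k: "continuous_on Ibar k" "\<And>x. x \<in> Ibar \<Longrightarrow> \<bar>k x\<bar> \<le> K"
      and g: "continuous_on Ibar g" "\<And>x. x \<in> Ibar \<Longrightarrow> \<bar>g x\<bar> \<le> B" and x: "x \<in> Ibar" and K: "0 < K"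
    for k K g B x
  proof (rule prim_abs_bound[OF continuous_on_mult[OF k(1) g(1)] _ x])
    fix t :: real assume t: "t \<in> Ibar"
    show "\<bar>k t * g t\<bar> \<le> K * B"
      unfolding abs_mult using k(2)[OF t] g(2)[OF t] K by (intro mult_mono) auto
  qed
  show thesis
  proof (rule that[OF C])
    fix f :: "real \<Rightarrow> real" and N
    assume f: "continuous_on Ibar f" and N: "\<And>x. x \<in> Ibar \<Longrightarrow> \<bar>f x\<bar> \<le> N"
    have N0: "0 \<le> N" using N[of 0] by simp
    define g3 where "g3 = prim f"
    define g2 where "g2 = prim (\<lambda>x. k3 x * g3 x)"
    define g1 where "g1 = prim (\<lambda>x. k2 x * g2 x)"
    define g0 where "g0 = prim (\<lambda>x. k1 x * g1 x)"
    have s3: "has_slope g3 f" unfolding g3_def by (rule prim_slope[OF f])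
    note c3 = has_slope_continuous[OF s3]
    have s2: "has_slope g2 (\<lambda>x. k3 x * g3 x)"
      unfolding g2_def by (intro prim_slope continuous_on_mult cont c3)
    note c2 = has_slope_continuous[OF s2]
    have s1: "has_slope g1 (\<lambda>x. k2 x * g2 x)"
      unfolding g1_def by (intro prim_slope continuous_on_mult cont c2)
    note c1 = has_slope_continuous[OF s1]
    have s0: "has_slope g0 (\<lambda>x. k1 x * g1 x)"
      unfolding g0_def by (intro prim_slope continuous_on_mult cont c1)
    have b3: "\<bar>g3 x\<bar> \<le> 2 * N" if "x \<in> Ibar" for x
      unfolding g3_def by (rule prim_abs_bound[OF f N that])
    have b2: "\<bar>g2 x\<bar> \<le> 2 * (K3 * (2 * N))" if "x \<in> Ibar" for x
      unfolding g2_def by (rule bnd[OF cont(3) K3(2) c3 b3 that K3(1)])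
    have b1: "\<bar>g1 x\<bar> \<le> G1 * N" if "x \<in> Ibar" for x
      using bnd[OF cont(2) K2(2) c2 b2 that K2(1)] by (simp add: g1_def G1_def mult_ac)
    have b0: "\<bar>g0 x\<bar> \<le> G0 * N" if "x \<in> Ibar" for x
      using bnd[OF cont(1) K1(2) c1 b1 that K1(1)] by (simp add: g0_def G0_def mult_ac)
    define \<alpha> where "\<alpha> = (S2 1 * g0 1 - S1 1 * g1 1) / det"
    define \<beta> where "\<beta> = (E 1 * g1 1 - Q 1 * g0 1) / det"
    have "\<bar>S2 1 * g0 1 - S1 1 * g1 1\<bar> \<le> \<bar>S2 1\<bar> * (G0 * N) + \<bar>S1 1\<bar> * (G1 * N)"
      using mult_left_mono[OF b0[of 1], of "\<bar>S2 1\<bar>"] mult_left_mono[OF b1[of 1], of "\<bar>S1 1\<bar>"]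
        abs_triangle_ineq4[of "S2 1 * g0 1" "S1 1 * g1 1"] by (simp add: abs_mult)
    then have \<alpha>b: "\<bar>\<alpha>\<bar> \<le> Ca * N"
      using det by (simp add: \<alpha>_def Ca_def field_simps)
    have "\<bar>E 1 * g1 1 - Q 1 * g0 1\<bar> \<le> \<bar>E 1\<bar> * (G1 * N) + \<bar>Q 1\<bar> * (G0 * N)"
      using mult_left_mono[OF b1[of 1], of "\<bar>E 1\<bar>"] mult_left_mono[OF b0[of 1], of "\<bar>Q 1\<bar>"]
        abs_triangle_ineq4[of "E 1 * g1 1" "Q 1 * g0 1"] by (simp add: abs_mult)
    then have \<beta>b: "\<bar>\<beta>\<bar> \<le> Cb * N"
      using det by (simp add: \<beta>_def Cb_def field_simps)
    define w where "w x = g0 x + (\<alpha> * E x + \<beta> * S1 x)" for x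
    define z1 where "z1 x = g1 x + (\<alpha> * Q x + \<beta> * S2 x)" for x
    define z2 where "z2 x = g2 x + (\<alpha> + \<beta> * R x)" for x
    define z3 where "z3 x = g3 x + \<beta>" for x
    have "has_slope w (\<lambda>x. k1 x * z1 x)"
      by (rule has_slope_cong[OF has_slope_add[OF s0 has_slope_add[OF
              has_slope_cmult[OF E_slope, of \<alpha>] has_slope_cmult[OF S1s, of \<beta>]]]])
        (simp_all add: w_def z1_def algebra_simps)
    moreover have "has_slope z1 (\<lambda>x. k2 x * z2 x)"
      by (rule has_slope_cong[OF has_slope_add[OF s1 has_slope_add[OF
              has_slope_cmult[OF Q_slope, of \<alpha>] has_slope_cmult[OF S2s, of \<beta>]]]])
        (simp_all add: z1_def z2_def algebra_simps)
    moreover have "has_slope z2 (\<lambda>x. k3 x * z3 x)"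
      by (rule has_slope_cong[OF has_slope_add[OF s2 has_slope_add[OF
              has_slope_const[of \<alpha>] has_slope_cmult[OF Rs, of \<beta>]]]])
        (simp_all add: z2_def z3_def algebra_simps)
    moreover have "has_slope z3 f"
      by (rule has_slope_cong[OF has_slope_add[OF s3 has_slope_const[of \<beta>]]]) (simp_all add: z3_def)
    moreover have "w (-1) = 0" "z1 (-1) = 0"
      using left Q_E_left by (simp_all add: w_def z1_def g0_def g1_def)
    moreover have "w 1 = 0"
    proof -
      have "det * w 1 = det * g0 1 + (det * \<alpha>) * E 1 + (det * \<beta>) * S1 1"
        by (simp add: w_def algebra_simps)
      also have "det * \<alpha> = S2 1 * g0 1 - S1 1 * g1 1" using det by (simp add: \<alpha>_def)
      also have "det * \<beta> = E 1 * g1 1 - Q 1 * g0 1" using det by (simp add: \<beta>_def)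
      finally have "det * w 1 = 0" by (simp add: det_def algebra_simps)
      then show ?thesis using det by simp
    qed
    moreover have "z1 1 = 0"
    proof -
      have "det * z1 1 = det * g1 1 + (det * \<alpha>) * Q 1 + (det * \<beta>) * S2 1"
        by (simp add: z1_def algebra_simps)
      also have "det * \<alpha> = S2 1 * g0 1 - S1 1 * g1 1" using det by (simp add: \<alpha>_def)
      also have "det * \<beta> = E 1 * g1 1 - Q 1 * g0 1" using det by (simp add: \<beta>_def)
      finally have "det * z1 1 = 0" by (simp add: det_def algebra_simps)
      then show ?thesis using det by simp
    qed
    ultimately have cl: "clamped w z1 z2 z3 f" by (simp add: clamped_def)
    have "\<bar>k1 x * z1 x\<bar> \<le> C * N" if x: "x \<in> Ibar" for x
    proof -
      have "\<bar>\<alpha> * Q x\<bar> \<le> (Ca * N) * MQ"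
        unfolding abs_mult using \<alpha>b MQ(2)[OF x] Cab N0 by (intro mult_mono) auto
      moreover have "\<bar>\<beta> * S2 x\<bar> \<le> (Cb * N) * MS"
        unfolding abs_mult using \<beta>b MS(2)[OF x] Cab N0 by (intro mult_mono) auto
      ultimately have "\<bar>z1 x\<bar> \<le> G1 * N + ((Ca * N) * MQ + (Cb * N) * MS)"
        using b1[OF x] unfolding z1_def by linarith
      then have "\<bar>k1 x * z1 x\<bar> \<le> K1 * (G1 * N + ((Ca * N) * MQ + (Cb * N) * MS))"
        unfolding abs_mult using K1(2)[OF x] K1(1) by (intro mult_mono) auto
      then show ?thesis by (simp add: C_def algebra_simps)
    qed
    then show "\<exists>w z1 z2 z3. clamped w z1 z2 z3 f \<and> (\<forall>x\<in>Ibar. \<bar>k1 x * z1 x\<bar> \<le> C * N)"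
      using cl by blast
  qed
qed

end

text \<open>
  The weight \<open>m\<close> collects the factors by which the last equation \<open>z\<^sub>3' = \<mu> m w\<close> differs from \<open>\<mu> w\<close>, so
  that the eigenvalue problem reads \<open>w = \<mu> T w\<close>.
\<close>

locale weighted_chain = positive_chain +
  fixes m :: "real \<Rightarrow> real"
  assumes m_cont: "continuous_on Ibar m" and m_pos: "\<And>x. x \<in> Ibar \<Longrightarrow> 0 < m x"
begin

text \<open>
  The choice is determined on the closed interval by \<open>clamped_unique\<close>.
\<close>

definition T :: "(real \<Rightarrow> real) \<Rightarrow> real \<Rightarrow> real" where
  "T f = (SOME w. \<exists>z1 z2 z3. clamped w z1 z2 z3 (\<lambda>x. m x * f x))"

lemma mf_cont: "continuous_on Ibar f \<Longrightarrow> continuous_on Ibar (\<lambda>x. m x * f x)"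
  by (intro continuous_on_mult m_cont)

lemma T_solves:
  assumes f: "continuous_on Ibar f"
  shows "\<exists>z1 z2 z3. clamped (T f) z1 z2 z3 (\<lambda>x. m x * f x)"
proof -
  obtain B where B: "\<And>x. x \<in> Ibar \<Longrightarrow> \<bar>m x * f x\<bar> \<le> B"
    by (rule continuous_bounded[OF mf_cont[OF f]]) auto
  obtain C where "\<And>f N. continuous_on Ibar f \<Longrightarrow> (\<And>x. x \<in> Ibar \<Longrightarrow> \<bar>f x\<bar> \<le> N) \<Longrightarrow>
      \<exists>w z1 z2 z3. clamped w z1 z2 z3 f \<and> (\<forall>x\<in>Ibar. \<bar>k1 x * z1 x\<bar> \<le> C * N)"
    by (rule clamped_solvable) blast
  from this[OF mf_cont[OF f] B]
  have "\<exists>w z1 z2 z3. clamped w z1 z2 z3 (\<lambda>x. m x * f x)" by blast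
  then show ?thesis unfolding T_def by (rule someI_ex)
qed

lemma T_unique:
  assumes c: "clamped w z1 z2 z3 h" and h: "\<And>x. x \<in> Ibar \<Longrightarrow> h x = m x * f x"
    and f: "continuous_on Ibar f" and x: "x \<in> Ibar"
  shows "T f x = w x"
proof -
  obtain z1' z2' z3' where c': "clamped (T f) z1' z2' z3' (\<lambda>x. m x * f x)"
    using T_solves[OF f] by blast
  show ?thesis by (rule clamped_unique[OF c' c _ x]) (simp add: h)
qed

lemma T_lipschitz:
  obtains B where "0 < B"
    "\<And>f x y. continuous_on Ibar f \<Longrightarrow> (\<And>x. x \<in> Ibar \<Longrightarrow> \<bar>f x\<bar> \<le> 1) \<Longrightarrow> x \<in> Ibar \<Longrightarrow> y \<in> Ibar \<Longrightarrow>
      \<bar>T f x - T f y\<bar> \<le> B * \<bar>x - y\<bar>"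
proof -
  obtain M where M: "0 < M" "\<And>x. x \<in> Ibar \<Longrightarrow> \<bar>m x\<bar> \<le> M"
    by (rule continuous_bounded[OF m_cont]) auto
  obtain C where C: "0 < C" and ex: "\<And>f N. continuous_on Ibar f \<Longrightarrow> (\<And>x. x \<in> Ibar \<Longrightarrow> \<bar>f x\<bar> \<le> N) \<Longrightarrow>
      \<exists>w z1 z2 z3. clamped w z1 z2 z3 f \<and> (\<forall>x\<in>Ibar. \<bar>k1 x * z1 x\<bar> \<le> C * N)"
    by (rule clamped_solvable) blast
  show thesis
  proof (rule that[of "C * M"])
    show "0 < C * M" using C M by simp
    fix f :: "real \<Rightarrow> real" and x y :: real
    assume f: "continuous_on Ibar f" and b: "\<And>x. x \<in> Ibar \<Longrightarrow> \<bar>f x\<bar> \<le> 1"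
      and xy: "x \<in> Ibar" "y \<in> Ibar"
    have "\<bar>m x * f x\<bar> \<le> M" if "x \<in> Ibar" for x
      using mult_mono[OF M(2)[OF that] b[OF that]] M by (simp add: abs_mult)
    from ex[OF mf_cont[OF f] this] obtain w z1 z2 z3 where
      c: "clamped w z1 z2 z3 (\<lambda>x. m x * f x)" and z1: "\<forall>x\<in>Ibar. \<bar>k1 x * z1 x\<bar> \<le> C * M"
      by blast
    have s: "has_slope w (\<lambda>x. k1 x * z1 x)" using c by (simp add: clamped_def)
    have "\<bar>w x - w y\<bar> \<le> C * M * \<bar>x - y\<bar>"
      by (rule has_slope_lipschitz[OF s bspec[OF z1] xy])
    moreover have "T f x = w x" "T f y = w y"
      by (rule T_unique[OF c refl f xy(1)], rule T_unique[OF c refl f xy(2)])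
    ultimately show "\<bar>T f x - T f y\<bar> \<le> C * M * \<bar>x - y\<bar>" by simp
  qed
qed

lemma T_left: "continuous_on Ibar f \<Longrightarrow> T f (-1) = 0"
  using T_solves unfolding clamped_def by blast

lemma T_lower:
  assumes f: "continuous_on Ibar f" "\<forall>x\<in>Ibar. 0 \<le> f x" and y: "y \<in> Ibar" "f y \<noteq> 0"
  shows "\<exists>\<delta>>0. \<forall>x\<in>Ibar. \<delta> * envelope x \<le> T f x"
proof -
  obtain z1 z2 z3 where c: "clamped (T f) z1 z2 z3 (\<lambda>x. m x * f x)" using T_solves[OF f(1)] by blast
  have mn: "0 \<le> m x * f x" if "x \<in> Ibar" for x
    by (rule mult_nonneg_nonneg[OF less_imp_le[OF m_pos[OF that]] bspec[OF f(2) that]])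
  have my: "m y * f y \<noteq> 0" using m_pos[OF y(1)] y(2) by simp
  obtain \<delta> where "0 < \<delta>" "\<And>x. x \<in> Ibar \<Longrightarrow> \<delta> * envelope x \<le> T f x"
    by (rule clamped_lower[OF c mn y(1) my]) auto
  then show ?thesis by blast
qed

lemma T_upper:
  assumes f: "continuous_on Ibar f"
  shows "\<exists>K>0. \<forall>x\<in>Ibar. T f x \<le> K * envelope x"
proof -
  obtain z1 z2 z3 where c: "clamped (T f) z1 z2 z3 (\<lambda>x. m x * f x)" using T_solves[OF f] by blast
  then have "continuous_on Ibar z2" by (auto simp: clamped_def intro: has_slope_continuous)
  then obtain K where K: "0 < K" "\<And>x. x \<in> Ibar \<Longrightarrow> \<bar>z2 x\<bar> \<le> K"
    by (rule continuous_bounded) auto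
  have "z2 x \<le> K" if "x \<in> Ibar" for x using K(2)[OF that] by simp
  from clamped_upper[OF c this less_imp_le[OF K(1)]] K(1) show ?thesis by blast
qed

text \<open>
  Domination follows by squeezing the envelope between \<open>T g\<close> and \<open>T f\<close>; compactness is the
  Arzela-Ascoli theorem for a family with a common Lipschitz constant and the value 0 at the left
  end point.
\<close>

sublocale strongly_positive_compact T
proof
  show T_cont: "continuous_on Ibar (T f)" if "continuous_on Ibar f" for f
    using T_solves[OF that] by (auto simp: clamped_def intro: has_slope_continuous)
  show "T (\<lambda>x. f x + c * g x) x = T f x + c * T g x"
    if f: "continuous_on Ibar f" and g: "continuous_on Ibar g" and x: "x \<in> Ibar" for f g c x
  proof -
    obtain z1 z2 z3 where c: "clamped (T f) z1 z2 z3 (\<lambda>x. m x * f x)" using T_solves[OF f] by blast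
    obtain z1' z2' z3' where c': "clamped (T g) z1' z2' z3' (\<lambda>x. m x * g x)"
      using T_solves[OF g] by blast
    show ?thesis
      by (rule T_unique[OF clamped_add[OF c c'] _ _ x])
        (auto simp: algebra_simps intro!: continuous_intros f g)
  qed
  show "0 \<le> T f x" if f: "continuous_on Ibar f" "\<forall>x\<in>Ibar. 0 \<le> f x" and x: "x \<in> Ibar" for f x
  proof -
    obtain z1 z2 z3 where c: "clamped (T f) z1 z2 z3 (\<lambda>x. m x * f x)" using T_solves[OF f(1)] by blast
    have "0 \<le> m x * f x" if "x \<in> Ibar" for x
      by (rule mult_nonneg_nonneg[OF less_imp_le[OF m_pos[OF that]] bspec[OF f(2) that]])
    then show ?thesis by (rule clamped_nonneg[OF c _ x])
  qed
  show "\<exists>\<epsilon>>0. \<forall>x\<in>Ibar. \<epsilon> * T g x \<le> T f x"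
    if f: "continuous_on Ibar f" "\<forall>x\<in>Ibar. 0 \<le> f x" and y: "y \<in> Ibar" "f y \<noteq> 0"
      and g: "continuous_on Ibar g" for f g y
  proof -
    obtain \<delta> where \<delta>: "0 < \<delta>" "\<forall>x\<in>Ibar. \<delta> * envelope x \<le> T f x" using T_lower[OF f y] by blast
    obtain K where K: "0 < K" "\<forall>x\<in>Ibar. T g x \<le> K * envelope x" using T_upper[OF g] by blast
    have "\<delta> / K * T g x \<le> T f x" if x: "x \<in> Ibar" for x
    proof -
      have "\<delta> / K * T g x \<le> \<delta> / K * (K * envelope x)"
        by (rule mult_left_mono[OF bspec[OF K(2) x]]) (use \<delta> K in simp)
      also have "\<dots> = \<delta> * envelope x" using K(1) by simp
      also have "\<dots> \<le> T f x" using \<delta>(2) x by blast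
      finally show ?thesis .
    qed
    moreover have "0 < \<delta> / K" using \<delta> K by simp
    ultimately show ?thesis by blast
  qed
  show "\<exists>y\<in>Ibar. T (\<lambda>_. 1) y \<noteq> 0"
  proof -
    obtain \<delta> where \<delta>: "0 < \<delta>" "\<forall>x\<in>Ibar. \<delta> * envelope x \<le> T (\<lambda>_. 1) x"
      using T_lower[of "\<lambda>_. 1" 0] by auto
    have "0 < \<delta> * envelope 0" using \<delta> envelope_pos[of 0] by simp
    then have "T (\<lambda>_. 1) 0 \<noteq> 0" using bspec[OF \<delta>(2), of 0] by simp
    then show ?thesis by (intro bexI[of _ 0]) auto
  qed
  fix f :: "nat \<Rightarrow> real \<Rightarrow> real"
  assume fc: "\<And>n. continuous_on Ibar (f n)" and fb: "\<And>n x. x \<in> Ibar \<Longrightarrow> \<bar>f n x\<bar> \<le> 1"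
  obtain B where B: "0 < B" and lip: "\<And>f x y. continuous_on Ibar f \<Longrightarrow>
      (\<And>x. x \<in> Ibar \<Longrightarrow> \<bar>f x\<bar> \<le> 1) \<Longrightarrow> x \<in> Ibar \<Longrightarrow> y \<in> Ibar \<Longrightarrow> \<bar>T f x - T f y\<bar> \<le> B * \<bar>x - y\<bar>"
    by (rule T_lipschitz) blast
  have L: "\<bar>T (f n) x - T (f n) y\<bar> \<le> B * \<bar>x - y\<bar>" if "x \<in> Ibar" "y \<in> Ibar" for n x y
    by (rule lip[OF fc fb that])
  obtain g r where g: "continuous_on Ibar g" "strict_mono (r :: nat \<Rightarrow> nat)"
    and lim: "\<And>e. 0 < e \<Longrightarrow> \<exists>N. \<forall>n x. n \<ge> N \<and> x \<in> Ibar \<longrightarrow> norm (T (f (r n)) x - g x) < e"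
  proof (rule Arzela_Ascoli[of Ibar "\<lambda>n. T (f n)" "B * 2"])
    fix n and x :: real assume x: "x \<in> Ibar"
    have "\<bar>T (f n) x\<bar> \<le> B * \<bar>x - (-1)\<bar>" using L[of x "-1" n] x T_left[OF fc] by simp
    also have "\<dots> \<le> B * 2" using B x by (intro mult_left_mono) auto
    finally show "norm (T (f n) x) \<le> B * 2" by simp
  next
    fix x d :: real assume x: "x \<in> Ibar" and d: "0 < d"
    have "norm (T (f n) x - T (f n) y) < d" if y: "y \<in> Ibar" and n: "norm (x - y) < d / B" for n y
    proof -
      have "B * \<bar>x - y\<bar> < d" using n B by (simp add: field_simps)
      then show ?thesis using L[OF x y, of n] by simp
    qed
    then show "\<exists>\<delta>. 0 < \<delta> \<and> (\<forall>n y. y \<in> Ibar \<and> norm (x - y) < \<delta> \<longrightarrow> norm (T (f n) x - T (f n) y) < d)"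
      using d B by (intro exI[of _ "d / B"]) auto
  qed auto
  have "uniform_limit Ibar (\<lambda>n. T (f (r n))) g sequentially"
    unfolding uniform_limit_sequentially_iff dist_norm using lim by blast
  then show "\<exists>g r. strict_mono (r :: nat \<Rightarrow> nat) \<and> continuous_on Ibar g \<and>
      uniform_limit Ibar (\<lambda>n. T (f (r n))) g sequentially"
    using g by blast
qed

end

section \<open>Positive solutions of second order equations\<close>

lemma prim_add:
  assumes "continuous_on Ibar f" "continuous_on Ibar g" "x \<in> Ibar"
  shows "prim (\<lambda>x. f x + c * g x) x = prim f x + c * prim g x"
proof (rule has_slope_eq[OF _ _ _ assms(3)])
  show "has_slope (prim (\<lambda>x. f x + c * g x)) (\<lambda>x. f x + c * g x)"
    by (intro prim_slope continuous_intros assms)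
  show "has_slope (\<lambda>x. prim f x + c * prim g x) (\<lambda>x. f x + c * g x)"
    by (intro has_slope_add has_slope_cmult prim_slope assms)
qed simp

lemma prim_cong:
  assumes "\<And>t. t \<in> Ibar \<Longrightarrow> f t = g t" "x \<in> Ibar"
  shows "prim f x = prim g x"
  unfolding prim_def by (rule integral_cong) (use assms in auto)

text \<open>
  The Volterra operator of \<open>(v' / p)' = q v\<close>: this equation with \<open>v(-1) = 1\<close> and \<open>v'(-1) = 0\<close> amounts to
  \<open>v = 1 + double_prim p q v\<close>.
\<close>

definition double_prim ::
  "(real \<Rightarrow> real) \<Rightarrow> (real \<Rightarrow> real) \<Rightarrow> (real \<Rightarrow> real) \<Rightarrow> real \<Rightarrow> real" where
  "double_prim p q f = prim (\<lambda>t. p t * prim (\<lambda>s. q s * f s) t)"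

context
  fixes p q :: "real \<Rightarrow> real"
  assumes p: "continuous_on Ibar p" "\<And>x. x \<in> Ibar \<Longrightarrow> 0 \<le> p x"
    and q: "continuous_on Ibar q" "\<And>x. x \<in> Ibar \<Longrightarrow> 0 \<le> q x"
begin

lemma inner_continuous:
  "continuous_on Ibar f \<Longrightarrow> continuous_on Ibar (\<lambda>t. p t * prim (\<lambda>s. q s * f s) t)"
  by (intro continuous_on_mult p q prim_continuous)

lemma double_prim_continuous:
  "continuous_on Ibar f \<Longrightarrow> continuous_on Ibar (double_prim p q f)"
  unfolding double_prim_def by (rule prim_continuous[OF inner_continuous])

lemma double_prim_nonneg:
  assumes f: "continuous_on Ibar f" "\<And>x. x \<in> Ibar \<Longrightarrow> 0 \<le> f x" and x: "x \<in> Ibar"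
  shows "0 \<le> double_prim p q f x"
proof -
  have "0 \<le> prim (\<lambda>s. q s * f s) t" if "t \<in> Ibar" for t
    using f q by (intro prim_nonneg continuous_on_mult that mult_nonneg_nonneg) simp_all
  then show ?thesis
    unfolding double_prim_def using p(2)
    by (intro prim_nonneg[OF inner_continuous[OF f(1)] x] mult_nonneg_nonneg) simp_all
qed

lemma double_prim_add:
  assumes f: "continuous_on Ibar f" and g: "continuous_on Ibar g" and x: "x \<in> Ibar"
  shows "double_prim p q (\<lambda>x. f x + c * g x) x = double_prim p q f x + c * double_prim p q g x"
proof -
  have "prim (\<lambda>s. q s * (f s + c * g s)) t
      = prim (\<lambda>s. q s * f s) t + c * prim (\<lambda>s. q s * g s) t" if t: "t \<in> Ibar" for t
  proof -
    have "prim (\<lambda>s. q s * f s + c * (q s * g s)) t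
        = prim (\<lambda>s. q s * f s) t + c * prim (\<lambda>s. q s * g s) t"
      by (intro prim_add continuous_on_mult q f g t)
    then show ?thesis by (simp add: algebra_simps)
  qed
  then have "double_prim p q (\<lambda>x. f x + c * g x) x
      = prim (\<lambda>t. p t * prim (\<lambda>s. q s * f s) t + c * (p t * prim (\<lambda>s. q s * g s) t)) x"
    unfolding double_prim_def by (intro prim_cong x) (simp add: algebra_simps)
  also have "\<dots> = double_prim p q f x + c * double_prim p q g x"
    unfolding double_prim_def by (intro prim_add inner_continuous f g x)
  finally show ?thesis .
qed

lemma prim_le_power:
  assumes f: "continuous_on Ibar f" and x: "x \<in> Ibar"
    and b: "\<And>t. t \<in> Ibar \<Longrightarrow> f t \<le> c * ((t + 1) ^ n / fact n)"
  shows "prim f x \<le> c * ((x + 1) ^ Suc n / fact (Suc n))"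
proof -
  have "has_slope (\<lambda>x. (x + 1) ^ Suc n / fact (Suc n)) (\<lambda>x. (x + 1) ^ n / fact n)"
    unfolding has_slope_def
    by (auto intro!: derivative_eq_intros simp: field_simps simp del: power_Suc of_nat_Suc)
  then have s: "has_slope (\<lambda>x. c * ((x + 1) ^ Suc n / fact (Suc n)) + -1 * prim f x)
      (\<lambda>x. c * ((x + 1) ^ n / fact n) + -1 * f x)"
    by (intro has_slope_add has_slope_cmult prim_slope f)
  have nn: "0 \<le> c * ((t + 1) ^ n / fact n) + -1 * f t" if "-1 \<le> t" "t \<le> x" for t
    using b[of t] that x by simp
  show ?thesis
    using has_slope_mono[OF s, of "-1" x, OF _ _ _ nn] x by simp
qed

text \<open>
  Each application gains two powers of \<open>x + 1\<close> together with the matching factorial. This is what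
  makes the Neumann series of the Volterra operator converge however large \<open>p\<close> and \<open>q\<close> are.
\<close>

lemma double_prim_le_power:
  assumes f: "continuous_on Ibar f" and x: "x \<in> Ibar" and c: "0 \<le> c"
    and P: "\<And>x. x \<in> Ibar \<Longrightarrow> p x \<le> P" and Q: "\<And>x. x \<in> Ibar \<Longrightarrow> q x \<le> Q"
    and b: "\<And>t. t \<in> Ibar \<Longrightarrow> f t \<le> c * ((t + 1) ^ n / fact n)"
  shows "double_prim p q f x \<le> P * Q * c * ((x + 1) ^ Suc (Suc n) / fact (Suc (Suc n)))"
proof -
  have P0: "0 \<le> P" using P[OF x] p(2)[OF x] by linarith
  have Q0: "0 \<le> Q" using Q[OF x] q(2)[OF x] by linarith
  have inner: "prim (\<lambda>s. q s * f s) t \<le> Q * c * ((t + 1) ^ Suc n / fact (Suc n))"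
    if t: "t \<in> Ibar" for t
  proof (rule prim_le_power[OF _ t])
    show "continuous_on Ibar (\<lambda>s. q s * f s)" by (intro continuous_on_mult q f)
    fix s :: real assume s: "s \<in> Ibar"
    have pw: "0 \<le> c * ((s + 1) ^ n / fact n)"
      using s c by (intro mult_nonneg_nonneg) auto
    have "q s * f s \<le> q s * (c * ((s + 1) ^ n / fact n))"
      using b[OF s] q(2)[OF s] by (rule mult_left_mono)
    also have "\<dots> \<le> Q * (c * ((s + 1) ^ n / fact n))"
      using Q[OF s] pw by (rule mult_right_mono)
    finally show "q s * f s \<le> Q * c * ((s + 1) ^ n / fact n)" by (simp add: mult.assoc)
  qed
  show ?thesis
    unfolding double_prim_def
  proof (rule prim_le_power[OF inner_continuous[OF f] x])
    fix t :: real assume t: "t \<in> Ibar"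
    have pw: "0 \<le> Q * c * ((t + 1) ^ Suc n / fact (Suc n))"
      using t c Q0 by (intro mult_nonneg_nonneg) auto
    have "p t * prim (\<lambda>s. q s * f s) t \<le> p t * (Q * c * ((t + 1) ^ Suc n / fact (Suc n)))"
      using inner[OF t] p(2)[OF t] by (rule mult_left_mono)
    also have "\<dots> \<le> P * (Q * c * ((t + 1) ^ Suc n / fact (Suc n)))"
      using P[OF t] pw by (rule mult_right_mono)
    finally show "p t * prim (\<lambda>s. q s * f s) t \<le> P * Q * c * ((t + 1) ^ Suc n / fact (Suc n))"
      by (simp add: mult.assoc)
  qed
qed

text \<open>
  The solution is the Neumann series \<open>v = \<Sum>n. u n\<close> with \<open>u 0 = 1\<close>, dominated by an exponential series.
  All its terms are nonnegative, hence \<open>v \<ge> 1\<close>.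
\<close>

lemma volterra_solution:
  obtains v where "continuous_on Ibar v" "\<And>x. x \<in> Ibar \<Longrightarrow> 1 \<le> v x"
    "\<And>x. x \<in> Ibar \<Longrightarrow> v x = 1 + double_prim p q v x"
proof -
  obtain P where P: "0 < P" "\<And>x. x \<in> Ibar \<Longrightarrow> \<bar>p x\<bar> \<le> P" by (rule continuous_bounded[OF p(1)]) auto
  obtain R where R: "0 < R" "\<And>x. x \<in> Ibar \<Longrightarrow> \<bar>q x\<bar> \<le> R" by (rule continuous_bounded[OF q(1)]) auto
  define K where "K = double_prim p q"
  define u where "u n = (K ^^ n) (\<lambda>_. 1)" for n
  have u0: "u 0 = (\<lambda>_. 1)" and uS: "u (Suc n) = K (u n)" for n
    by (simp_all add: u_def)
  have uc: "continuous_on Ibar (u n)" for n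
    by (induction n) (auto simp: u0 uS K_def intro: double_prim_continuous)
  have un: "0 \<le> u n x" if "x \<in> Ibar" for n x
    using that by (induction n arbitrary: x) (auto simp: u0 uS K_def intro!: double_prim_nonneg uc)
  have ub: "u n x \<le> (P * R) ^ n * ((x + 1) ^ (2 * n) / fact (2 * n))" if "x \<in> Ibar" for n x
    using that
  proof (induction n arbitrary: x)
    case (Suc n)
    have "K (u n) x \<le> P * R * (P * R) ^ n * ((x + 1) ^ Suc (Suc (2 * n)) / fact (Suc (Suc (2 * n))))"
      unfolding K_def
      by (rule double_prim_le_power[OF uc Suc.prems])
        (use P R Suc.IH in \<open>auto simp: abs_le_iff\<close>)
    then show ?case by (simp add: uS)
  qed (simp add: u0)
  \<comment> \<open>The crude estimates \<open>x + 1 \<le> 2\<close> and \<open>fact n \<le> fact (2 * n)\<close> suffice for an exponential series.\<close>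
  have ub': "norm (u n x) \<le> (4 * P * R) ^ n / fact n" if x: "x \<in> Ibar" for n x
  proof -
    have "(x + 1) ^ (2 * n) \<le> 2 ^ (2 * n)" using x by (intro power_mono) auto
    moreover have "fact n \<le> (fact (2 * n) :: real)" by (rule fact_mono) simp
    ultimately have "(x + 1) ^ (2 * n) / fact (2 * n) \<le> 4 ^ n / fact n"
      using x by (intro frac_le) (auto simp: power_mult)
    then have "(P * R) ^ n * ((x + 1) ^ (2 * n) / fact (2 * n)) \<le> (P * R) ^ n * (4 ^ n / fact n)"
      using P R by (intro mult_left_mono) auto
    then show ?thesis using ub[OF x, of n] un[OF x, of n] by (simp add: power_mult_distrib mult_ac)
  qed
  have sm: "summable (\<lambda>n. (4 * P * R) ^ n / fact n)"
    using summable_exp[of "4 * P * R"] by (simp add: field_simps)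
  define v where "v x = (\<Sum>n. u n x)" for x
  define s where "s n x = (\<Sum>i<n. u i x)" for n x
  have lim: "uniform_limit Ibar s v sequentially"
    unfolding s_def v_def by (rule Weierstrass_m_test[OF ub' sm])
  have sc: "continuous_on Ibar (s n)" for n
    unfolding s_def by (intro continuous_on_sum uc)
  have vc: "continuous_on Ibar v"
    by (rule uniform_limit_theorem[OF _ lim]) (simp_all add: sc)
  have vn: "0 \<le> v x" if x: "x \<in> Ibar" for x
    unfolding v_def
  proof (rule suminf_nonneg)
    show "summable (\<lambda>n. u n x)"
      by (rule summable_comparison_test'[OF sm, of 0]) (use ub' x in auto)
  qed (rule un[OF x])
  have step: "K (s n) x = s (Suc n) x - 1" if x: "x \<in> Ibar" for n x
  proof (induction n)
    case 0
    have "K (\<lambda>x. 1 + (-1) * 1) x = K (\<lambda>_. 1) x + (-1) * K (\<lambda>_. 1) x"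
      unfolding K_def by (intro double_prim_add x continuous_on_const)
    then show ?case by (simp add: s_def u0)
  next
    case (Suc n)
    have "K (\<lambda>x. s n x + 1 * u n x) x = K (s n) x + 1 * K (u n) x"
      unfolding K_def by (intro double_prim_add sc uc x)
    moreover have "s (Suc n) = (\<lambda>x. s n x + 1 * u n x)"
      by (auto simp: s_def)
    ultimately show ?case
      using Suc by (simp add: uS s_def)
  qed
  have fixp: "v x = 1 + K v x" if x: "x \<in> Ibar" for x
  proof -
    have "(\<lambda>n. K (s n) x) \<longlonglongrightarrow> K v x"
    proof (rule LIMSEQ_I)
      fix r :: real assume r: "0 < r"
      define d where "d = r / (8 * P * R)"
      have d: "0 < d" using r P R by (simp add: d_def)
      have "\<forall>\<^sub>F n in sequentially. \<forall>x\<in>Ibar. dist (s n x) (v x) < d"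
        using uniform_limitD[OF lim d] .
      then obtain N where N: "\<And>n y. n \<ge> N \<Longrightarrow> y \<in> Ibar \<Longrightarrow> \<bar>s n y - v y\<bar> < d"
        unfolding eventually_sequentially dist_real_def by blast
      have "norm (K (s n) x - K v x) < r" if n: "n \<ge> N" for n
      proof -
        define g where "g = (\<lambda>y. s n y + (-1) * v y)"
        have gc: "continuous_on Ibar g" unfolding g_def by (intro continuous_intros sc vc)
        have gb: "\<bar>g y\<bar> \<le> d" if "y \<in> Ibar" for y
          using N[OF n that] by (simp add: g_def)
        have "\<bar>q y * g y\<bar> \<le> R * d" if "y \<in> Ibar" for y
          unfolding abs_mult using R(2)[OF that] gb[OF that] R(1) by (intro mult_mono) auto
        then have 1: "\<bar>prim (\<lambda>s. q s * g s) y\<bar> \<le> 2 * (R * d)" if "y \<in> Ibar" for y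
          by (intro prim_abs_bound continuous_on_mult q gc that)
        have "\<bar>p y * prim (\<lambda>s. q s * g s) y\<bar> \<le> P * (2 * (R * d))" if "y \<in> Ibar" for y
          unfolding abs_mult using P(2)[OF that] 1[OF that] P(1) by (intro mult_mono) auto
        then have "\<bar>K g x\<bar> \<le> 2 * (P * (2 * (R * d)))"
          unfolding K_def double_prim_def by (intro prim_abs_bound inner_continuous gc x)
        also have "\<dots> < r" using r P R by (simp add: d_def field_simps)
        finally have "\<bar>K g x\<bar> < r" .
        moreover have "K g x = K (s n) x + (-1) * K v x"
          unfolding K_def g_def by (intro double_prim_add sc vc x)
        ultimately show ?thesis by simp
      qed
      then show "\<exists>N. \<forall>n\<ge>N. norm (K (s n) x - K v x) < r" by blast
    qed
    moreover have "(\<lambda>n. K (s n) x) \<longlonglongrightarrow> v x - 1"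
    proof -
      have "(\<lambda>n. s n x) \<longlonglongrightarrow> v x" by (rule tendsto_uniform_limitI[OF lim x])
      then have "(\<lambda>n. s (Suc n) x - 1) \<longlonglongrightarrow> v x - 1"
        by (intro tendsto_diff tendsto_const) (rule LIMSEQ_Suc)
      then show ?thesis by (simp add: step[OF x])
    qed
    ultimately have "K v x = v x - 1" by (rule LIMSEQ_unique)
    then show ?thesis by simp
  qed
  show thesis
  proof (rule that[OF vc])
    fix x :: real assume x: "x \<in> Ibar"
    show "v x = 1 + double_prim p q v x" using fixp[OF x] by (simp add: K_def)
    moreover have "0 \<le> double_prim p q v x" by (rule double_prim_nonneg[OF vc vn x])
    ultimately show "1 \<le> v x" by linarith
  qed
qed

end

text \<open>
  With the integrating factor \<open>exp B\<close>, where \<open>B' = b / a\<close>, the equation \<open>a v'' + b v' + c v = 0\<close> becomes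
  \<open>(exp B v')' = - (c / a) exp B v\<close>, and \<open>c \<le> 0\<close> makes the kernel on the right nonnegative.
\<close>

lemma positive_solution:
  assumes c: "continuous_on Ibar a" "continuous_on Ibar b" "continuous_on Ibar c"
    and a: "\<And>x. x \<in> Ibar \<Longrightarrow> 0 < a x" and neg: "\<And>x. x \<in> Ibar \<Longrightarrow> c x \<le> 0"
  obtains v v' where "has_slope v v'" "has_slope v' (\<lambda>x. - (b x * v' x + c x * v x) / a x)"
    "\<And>x. x \<in> Ibar \<Longrightarrow> 1 \<le> v x"
proof -
  have a0: "\<forall>x\<in>Ibar. a x \<noteq> 0" using a by force
  define B where "B = prim (\<lambda>x. b x / a x)"
  have Bs: "has_slope B (\<lambda>x. b x / a x)"
    unfolding B_def by (intro prim_slope continuous_on_divide c a0)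
  define p where "p x = exp (-1 * B x)" for x
  define q where "q x = - c x / a x * exp (B x)" for x
  have ps: "has_slope p (\<lambda>x. exp (-1 * B x) * (-1 * (b x / a x)))"
    unfolding p_def by (intro has_slope_exp has_slope_cmult Bs)
  have pc: "continuous_on Ibar p" by (rule has_slope_continuous[OF ps])
  have qc: "continuous_on Ibar q"
    unfolding q_def
    by (intro continuous_on_mult continuous_on_divide continuous_on_minus continuous_on_exp c a0
        has_slope_continuous[OF Bs])
  have qn: "0 \<le> q x" if "x \<in> Ibar" for x
    unfolding q_def using a[OF that] neg[OF that] by (intro mult_nonneg_nonneg divide_nonneg_pos) auto
  obtain v where v: "continuous_on Ibar v" "\<And>x. x \<in> Ibar \<Longrightarrow> 1 \<le> v x"
    "\<And>x. x \<in> Ibar \<Longrightarrow> v x = 1 + double_prim p q v x"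
    by (rule volterra_solution[OF pc _ qc qn]) (simp_all add: p_def)
  define v' where "v' x = p x * prim (\<lambda>s. q s * v s) x" for x
  have qv: "continuous_on Ibar (\<lambda>s. q s * v s)" by (intro continuous_on_mult qc v)
  have v's: "has_slope v' (\<lambda>x. exp (-1 * B x) * (-1 * (b x / a x)) * prim (\<lambda>s. q s * v s) x
      + p x * (q x * v x))"
    unfolding v'_def by (intro has_slope_mult ps prim_slope qv)
  have "has_slope (\<lambda>x. 1 + double_prim p q v x) (\<lambda>x. 0 + v' x)"
    unfolding double_prim_def v'_def
    by (intro has_slope_add has_slope_const prim_slope continuous_on_mult pc prim_continuous qv)
  then have vs: "has_slope v v'"
    by (rule has_slope_cong) (simp_all add: v(3)[symmetric])
  have "has_slope v' (\<lambda>x. - (b x * v' x + c x * v x) / a x)"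
  proof (rule has_slope_cong[OF v's])
    fix x :: real assume x: "x \<in> Ibar"
    have e: "exp (- B x) * (exp (B x) * t) = t" for t
      by (simp add: exp_minus field_simps)
    show "exp (-1 * B x) * (-1 * (b x / a x)) * prim (\<lambda>s. q s * v s) x + p x * (q x * v x)
        = - (b x * v' x + c x * v x) / a x"
      using a[OF x] by (simp add: v'_def p_def q_def exp_minus field_simps)
  qed simp
  then show thesis by (rule that[OF vs _ v(2)])
qed

section \<open>Smoothness classes\<close>

lemma deriv_on_eq:
  assumes "has_slope f f'" "x \<in> Ibar"
  shows "deriv_on Ibar f x = f' x"
proof -
  have "x islimpt Ibar" using assms(2) by (intro connected_imp_perfect) auto
  then have "at x within Ibar \<noteq> bot" by (simp add: trivial_limit_within)
  moreover have "(f has_vector_derivative f' x) (at x within Ibar)"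
    using assms by (simp add: has_slope_def has_real_derivative_iff_has_vector_derivative)
  ultimately show ?thesis unfolding deriv_on_def by (rule vector_derivative_within)
qed

lemma has_slope_deriv_on:
  assumes "f differentiable_on Ibar"
  shows "has_slope f (deriv_on Ibar f)"
  using assms
  by (auto simp: has_slope_def deriv_on_def differentiable_on_def vector_derivative_works
      has_real_derivative_iff_has_vector_derivative)

lemma has_slope_differentiable: "has_slope f f' \<Longrightarrow> f differentiable_on Ibar"
  unfolding has_slope_def differentiable_on_def
  using has_field_derivative_imp_has_derivative differentiableI by blast

lemma C_on_cong:
  "\<forall>x\<in>Ibar. f x = g x \<Longrightarrow> C_on k Ibar f \<Longrightarrow> C_on k Ibar g"
proof (induction k arbitrary: f g)
  case 0
  then show ?case using continuous_on_cong[of Ibar Ibar f g] by simp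
next
  case (Suc k)
  have f: "has_slope f (deriv_on Ibar f)"
    using Suc.prems(2) by (intro has_slope_deriv_on) simp
  have g: "has_slope g (deriv_on Ibar f)"
    by (rule has_slope_cong[OF f]) (use Suc.prems(1) in auto)
  have "C_on k Ibar (deriv_on Ibar g)"
    by (rule Suc.IH[of "deriv_on Ibar f"]) (use Suc.prems(2) deriv_on_eq[OF g] in auto)
  then show ?case using has_slope_differentiable[OF g] by simp
qed

text \<open>
  Together with \<open>C_on_SucD\<close> and \<open>C_on_slope\<close> this allows any derivative known on the interval to take the
  place of \<open>deriv_on\<close>.
\<close>

lemma C_on_SucI:
  assumes "has_slope f f'" "C_on k Ibar f'"
  shows "C_on (Suc k) Ibar f"
proof -
  have "C_on k Ibar (deriv_on Ibar f)"
    by (rule C_on_cong[OF _ assms(2)]) (use deriv_on_eq[OF assms(1)] in auto)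
  then show ?thesis using has_slope_differentiable[OF assms(1)] by simp
qed

lemma C_on_SucD:
  assumes "C_on (Suc k) Ibar f"
  shows "has_slope f (deriv_on Ibar f)" "C_on k Ibar (deriv_on Ibar f)"
  using assms has_slope_deriv_on by auto

lemma C_on_slope:
  assumes "C_on (Suc k) Ibar f" "has_slope f f'"
  shows "C_on k Ibar f'"
  by (rule C_on_cong[OF _ C_on_SucD(2)[OF assms(1)]]) (use deriv_on_eq[OF assms(2)] in auto)

lemma C_on_pred: "C_on (Suc k) Ibar f \<Longrightarrow> C_on k Ibar f"
proof (induction k arbitrary: f)
  case 0
  show ?case using has_slope_continuous[OF C_on_SucD(1)[OF 0]] by simp
next
  case (Suc k)
  show ?case
    by (rule C_on_SucI[OF C_on_SucD(1)[OF Suc.prems] Suc.IH[OF C_on_SucD(2)[OF Suc.prems]]])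
qed

lemma C_on_le: "C_on n Ibar f \<Longrightarrow> k \<le> n \<Longrightarrow> C_on k Ibar f"
  by (induction n) (auto simp: le_Suc_eq dest: C_on_pred simp del: C_on.simps)

lemma C_on_continuous: "C_on k Ibar f \<Longrightarrow> continuous_on Ibar f"
  using C_on_le[of k f 0] by simp

lemma C_on_add: "C_on k Ibar f \<Longrightarrow> C_on k Ibar g \<Longrightarrow> C_on k Ibar (\<lambda>x. f x + c * g x)"
proof (induction k arbitrary: f g)
  case 0
  then show ?case by (auto intro!: continuous_intros)
next
  case (Suc k)
  show ?case
    by (rule C_on_SucI[OF has_slope_add[OF C_on_SucD(1)[OF Suc.prems(1)]
            has_slope_cmult[OF C_on_SucD(1)[OF Suc.prems(2)]]]])
      (rule Suc.IH[OF C_on_SucD(2)[OF Suc.prems(1)] C_on_SucD(2)[OF Suc.prems(2)]])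
qed

lemma C_on_mult: "C_on k Ibar f \<Longrightarrow> C_on k Ibar g \<Longrightarrow> C_on k Ibar (\<lambda>x. f x * g x)"
proof (induction k arbitrary: f g)
  case 0
  then show ?case by (auto intro!: continuous_intros)
next
  case (Suc k)
  note f = Suc.prems(1) and g = Suc.prems(2)
  have "C_on k Ibar (\<lambda>x. deriv_on Ibar f x * g x + 1 * (f x * deriv_on Ibar g x))"
    by (intro C_on_add Suc.IH C_on_SucD(2) f g C_on_pred[OF f] C_on_pred[OF g])
  then have "C_on k Ibar (\<lambda>x. deriv_on Ibar f x * g x + f x * deriv_on Ibar g x)" by simp
  then show ?case
    by (rule C_on_SucI[OF has_slope_mult[OF C_on_SucD(1)[OF f] C_on_SucD(1)[OF g]]])
qed

lemma C_on_divide: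
  "C_on k Ibar f \<Longrightarrow> C_on k Ibar g \<Longrightarrow> \<forall>x\<in>Ibar. g x \<noteq> 0 \<Longrightarrow> C_on k Ibar (\<lambda>x. f x / g x)"
proof (induction k arbitrary: f g)
  case 0
  then show ?case by (auto intro!: continuous_on_divide)
next
  case (Suc k)
  note f = Suc.prems(1) and g = Suc.prems(2)
  have "C_on k Ibar (\<lambda>x. (deriv_on Ibar f x * g x + -1 * (f x * deriv_on Ibar g x)) / (g x * g x))"
    by (intro Suc.IH C_on_add C_on_mult C_on_SucD(2) f g C_on_pred[OF f] C_on_pred[OF g])
      (use Suc.prems(3) in simp)
  then have "C_on k Ibar (\<lambda>x. (deriv_on Ibar f x * g x - f x * deriv_on Ibar g x) / (g x * g x))"
    by simp
  with has_slope_divide[OF C_on_SucD(1)[OF f] C_on_SucD(1)[OF g] bspec[OF Suc.prems(3)]]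
  show ?case by (rule C_on_SucI)
qed

lemma C_on_D: "C_on (n + k) Ibar f \<Longrightarrow> C_on n Ibar (D k f)"
  by (induction k arbitrary: n) (auto simp del: C_on.simps intro: C_on_SucD(2) simp: add_Suc_shift[symmetric])

lemma D_slope: "C_on (Suc k) Ibar f \<Longrightarrow> has_slope (D k f) (D (Suc k) f)"
  using C_on_SucD(1)[OF C_on_D[of "Suc 0" k f]] by simp

text \<open>
  Bootstrapping: the equation expresses \<open>\<phi>''\<close> by \<open>\<phi>'\<close>, \<open>\<phi>\<close> and \<open>g\<close>, so each derivative that \<open>\<phi>'\<close> is
  known to have gives one more, up to the smoothness of \<open>a\<close>, \<open>b\<close>, \<open>c\<close> and \<open>g\<close>.
\<close>

lemma C_on_solution:
  assumes \<phi>: "has_slope \<phi> \<phi>1" "has_slope \<phi>1 (\<lambda>x. (g x - b x * \<phi>1 x - c x * \<phi> x) / a x)"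
    and abc: "C_on k Ibar a" "C_on k Ibar b" "C_on k Ibar c" and a: "\<forall>x\<in>Ibar. a x \<noteq> 0"
    and g: "C_on k Ibar g"
  shows "C_on (Suc (Suc k)) Ibar \<phi>"
proof -
  have step: "C_on (Suc (Suc j)) Ibar \<phi>" if j: "j \<le> k" and 1: "C_on j Ibar \<phi>1" for j
  proof -
    have 0: "C_on j Ibar \<phi>" by (rule C_on_pred[OF C_on_SucI[OF \<phi>(1) 1]])
    have "C_on j Ibar (\<lambda>x. ((g x + -1 * (b x * \<phi>1 x)) + -1 * (c x * \<phi> x)) / a x)"
      by (intro C_on_divide C_on_add C_on_mult a 0 1 C_on_le[OF g j] C_on_le[OF abc(1) j]
          C_on_le[OF abc(2) j] C_on_le[OF abc(3) j])
    then have "C_on j Ibar (\<lambda>x. (g x - b x * \<phi>1 x - c x * \<phi> x) / a x)" by simp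
    then show ?thesis by (intro C_on_SucI[OF \<phi>(1)] C_on_SucI[OF \<phi>(2)])
  qed
  have "C_on (Suc (Suc j)) Ibar \<phi>" if "j \<le> k" for j
    using that
  proof (induction j)
    case 0
    show ?case by (rule step) (use has_slope_continuous[OF \<phi>(2)] in simp_all)
  next
    case (Suc j)
    have "C_on (Suc j) Ibar \<phi>1"
      by (rule C_on_slope[OF _ \<phi>(1)]) (use Suc in \<open>simp del: C_on.simps\<close>)
    then show ?case by (rule step[OF Suc.prems])
  qed
  from this[OF order_refl] show ?thesis .
qed


section \<open>Factorization of second order operators\<close>

text \<open>
  A positive solution \<open>v\<close> of \<open>a v'' + b v' + c v = 0\<close> and a primitive \<open>B\<close> of \<open>b / a\<close> factor the operator
  \<open>\<phi> \<mapsto> a \<phi>'' + b \<phi>' + c \<phi>\<close> into \<open>\<phi> \<mapsto> ((\<phi> / v)' / inner_weight)' / outer_weight\<close>.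
\<close>

locale sturm_factor =
  fixes a b c v v' B :: "real \<Rightarrow> real"
  assumes v: "has_slope v v'" "has_slope v' (\<lambda>x. - (b x * v' x + c x * v x) / a x)"
    and v_pos: "\<And>x. x \<in> Ibar \<Longrightarrow> 0 < v x"
    and B: "has_slope B (\<lambda>x. b x / a x)"
    and a_cont: "continuous_on Ibar a" and a_pos: "\<And>x. x \<in> Ibar \<Longrightarrow> 0 < a x"
begin

definition inner_weight :: "real \<Rightarrow> real" where "inner_weight x = 1 / (v x * v x * exp (B x))"
definition outer_weight :: "real \<Rightarrow> real" where "outer_weight x = v x * exp (B x) / a x"

lemma nonzero: "x \<in> Ibar \<Longrightarrow> v x \<noteq> 0" "x \<in> Ibar \<Longrightarrow> a x \<noteq> 0"
  using v_pos a_pos by force+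

lemma weights_continuous: "continuous_on Ibar inner_weight" "continuous_on Ibar outer_weight" "continuous_on Ibar v"
  unfolding inner_weight_def outer_weight_def
  by (auto intro!: continuous_intros has_slope_continuous[OF B] has_slope_continuous[OF v(1)] a_cont
      simp: nonzero)

lemma weights_pos: "x \<in> Ibar \<Longrightarrow> 0 < inner_weight x" "x \<in> Ibar \<Longrightarrow> 0 < outer_weight x"
  unfolding inner_weight_def outer_weight_def by (simp_all add: v_pos a_pos)

text \<open>
  \<open>W\<close> is the Wronskian of \<open>v\<close> and \<open>\<phi>\<close> multiplied by \<open>exp B\<close>. By Abel's identity this product is
  constant if \<open>\<phi>\<close> solves the homogeneous equation; in general its slope is the operator applied to
  \<open>\<phi>\<close>, up to the positive factor \<open>outer_weight\<close>.
\<close>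

lemma factor:
  assumes \<phi>: "has_slope \<phi> \<phi>1" "has_slope \<phi>1 \<phi>2"
  defines "W \<equiv> \<lambda>x. exp (B x) * (\<phi>1 x * v x + -1 * (\<phi> x * v' x))"
  shows "has_slope (\<lambda>x. \<phi> x / v x) (\<lambda>x. inner_weight x * W x)"
    and "has_slope W (\<lambda>x. outer_weight x * (a x * \<phi>2 x + b x * \<phi>1 x + c x * \<phi> x))"
proof -
  show "has_slope (\<lambda>x. \<phi> x / v x) (\<lambda>x. inner_weight x * W x)"
  proof (rule has_slope_cong[OF has_slope_divide[OF \<phi>(1) v(1)]])
    fix x :: real assume x: "x \<in> Ibar"
    show "(\<phi>1 x * v x - \<phi> x * v' x) / (v x * v x) = inner_weight x * W x"
      by (simp add: inner_weight_def W_def)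
  qed (simp_all add: nonzero)
  show "has_slope W (\<lambda>x. outer_weight x * (a x * \<phi>2 x + b x * \<phi>1 x + c x * \<phi> x))"
    unfolding W_def
  proof (rule has_slope_cong[OF has_slope_mult[OF has_slope_exp[OF B] has_slope_add[OF
            has_slope_mult[OF \<phi>(2) v(1)] has_slope_cmult[OF has_slope_mult[OF \<phi>(1) v(2)], of "-1"]]]])
    fix x :: real assume x: "x \<in> Ibar"
    show "exp (B x) * (b x / a x) * (\<phi>1 x * v x + - 1 * (\<phi> x * v' x)) + exp (B x) *
        (\<phi>2 x * v x + \<phi>1 x * v' x + - 1 * (\<phi>1 x * v' x + \<phi> x * (- (b x * v' x + c x * v x) / a x)))
      = outer_weight x * (a x * \<phi>2 x + b x * \<phi>1 x + c x * \<phi> x)"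
      using a_pos[OF x] by (simp add: outer_weight_def field_simps)
  qed simp
qed

text \<open>
  The converse reading of the factorization: from solutions of the two first order equations one
  recovers the function together with its first two derivatives.
\<close>

lemma unfactor:
  assumes w: "has_slope w (\<lambda>x. inner_weight x * W x)" and W: "has_slope W (\<lambda>x. outer_weight x * g x)"
  defines "\<phi> \<equiv> \<lambda>x. v x * w x" and "\<phi>1 \<equiv> \<lambda>x. v' x * w x + W x / (v x * exp (B x))"
  shows "has_slope \<phi> \<phi>1"
    and "has_slope \<phi>1 (\<lambda>x. (g x - b x * \<phi>1 x - c x * \<phi> x) / a x)"
proof -
  show "has_slope \<phi> \<phi>1"
    unfolding \<phi>_def
  proof (rule has_slope_cong[OF has_slope_mult[OF v(1) w]])
    fix x :: real assume x: "x \<in> Ibar"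
    show "v' x * w x + v x * (inner_weight x * W x) = \<phi>1 x"
      using v_pos[OF x] by (simp add: \<phi>1_def inner_weight_def)
  qed simp
  show "has_slope \<phi>1 (\<lambda>x. (g x - b x * \<phi>1 x - c x * \<phi> x) / a x)"
    unfolding \<phi>1_def
  proof (rule has_slope_cong[OF has_slope_add[OF has_slope_mult[OF v(2) w]
          has_slope_divide[OF W has_slope_mult[OF v(1) has_slope_exp[OF B]]]]])
    fix x :: real assume x: "x \<in> Ibar"
    show "- (b x * v' x + c x * v x) / a x * w x + v' x * (inner_weight x * W x) +
        (outer_weight x * g x * (v x * exp (B x)) - W x * (v' x * exp (B x) + v x * (exp (B x) * (b x / a x)))) /
        (v x * exp (B x) * (v x * exp (B x)))
      = (g x - b x * (v' x * w x + W x / (v x * exp (B x))) - c x * \<phi> x) / a x"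
      using v_pos[OF x] a_pos[OF x] by (simp add: \<phi>_def inner_weight_def outer_weight_def field_simps)
  qed (simp_all add: nonzero)
qed

end

lemma sturm_factor_exists:
  assumes c: "continuous_on Ibar a" "continuous_on Ibar b" "continuous_on Ibar c"
    and a: "\<And>x. x \<in> Ibar \<Longrightarrow> 0 < a x" and neg: "\<And>x. x \<in> Ibar \<Longrightarrow> c x \<le> 0"
  shows "\<exists>v v' B. sturm_factor a b c v v' B"
proof -
  obtain v v' where v: "has_slope v v'" "has_slope v' (\<lambda>x. - (b x * v' x + c x * v x) / a x)"
    "\<And>x. x \<in> Ibar \<Longrightarrow> 1 \<le> v x"
    using positive_solution[OF c a neg] by metis
  have "has_slope (prim (\<lambda>x. b x / a x)) (\<lambda>x. b x / a x)"
    by (intro prim_slope continuous_on_divide c) (use a in force)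
  moreover have "0 < v x" if "x \<in> Ibar" for x using v(3)[OF that] by simp
  ultimately have "sturm_factor a b c v v' (prim (\<lambda>x. b x / a x))"
    using v(1,2) c(1) a by unfold_locales
  then show ?thesis by blast
qed


section \<open>The fourth order eigenvalue problem\<close>

text \<open>
  The coefficients of \<open>L\<close> are those that the product rule produces when \<open>g = a\<^sub>1 u'' + b\<^sub>1 u' + c\<^sub>1 u\<close> is
  differentiated twice.
\<close>

lemma L_as_composition:
  assumes C: "C_on 2 Ibar a1" "C_on 2 Ibar b1" "C_on 2 Ibar c1" and u: "C_on 4 Ibar u"
    and g: "\<And>x. x \<in> Ibar \<Longrightarrow> g x = a1 x * D 2 u x + b1 x * D 1 u x + c1 x * u x"
    and g1: "has_slope g g1" and g2: "has_slope g1 g2" and x: "x \<in> Ibar"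
  shows "L a1 b1 c1 a2 b2 c2 u x = a2 x * g2 x + b2 x * g1 x + c2 x * g x"
proof -
  have D0: "D 0 f = f" for f by simp
  have s: "has_slope f (D 1 f)" "has_slope (D 1 f) (D 2 f)" if "C_on 2 Ibar f" for f
    using D_slope[of 0 f] D_slope[of 1 f] C_on_le[OF that] that
    by (simp_all del: C_on.simps add: numeral_2_eq_2)
  have us: "has_slope u (D 1 u)" "has_slope (D 1 u) (D 2 u)"
    "has_slope (D 2 u) (D 3 u)" "has_slope (D 3 u) (D 4 u)"
    using s[OF C_on_le[OF u]] D_slope[of 2 u] D_slope[of 3 u] C_on_le[OF u, of 3] u
    by (simp_all del: C_on.simps add: eval_nat_numeral)
  have h1: "has_slope (\<lambda>x. a1 x * D 2 u x + b1 x * D 1 u x + c1 x * u x)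
      (\<lambda>x. (D 1 a1 x * D 2 u x + a1 x * D 3 u x) + (D 1 b1 x * D 1 u x + b1 x * D 2 u x)
        + (D 1 c1 x * u x + c1 x * D 1 u x))"
    by (intro has_slope_add has_slope_mult s us C)
  have g1_eq: "g1 x = (D 1 a1 x * D 2 u x + a1 x * D 3 u x) + (D 1 b1 x * D 1 u x + b1 x * D 2 u x)
        + (D 1 c1 x * u x + c1 x * D 1 u x)" if "x \<in> Ibar" for x
    by (rule has_slope_unique[OF g1 has_slope_cong[OF h1] that]) (simp_all add: g)
  have h2: "has_slope (\<lambda>x. (D 1 a1 x * D 2 u x + a1 x * D 3 u x)
        + (D 1 b1 x * D 1 u x + b1 x * D 2 u x) + (D 1 c1 x * u x + c1 x * D 1 u x))
      (\<lambda>x. ((D 2 a1 x * D 2 u x + D 1 a1 x * D 3 u x) + (D 1 a1 x * D 3 u x + a1 x * D 4 u x))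
        + ((D 2 b1 x * D 1 u x + D 1 b1 x * D 2 u x) + (D 1 b1 x * D 2 u x + b1 x * D 3 u x))
        + ((D 2 c1 x * u x + D 1 c1 x * D 1 u x) + (D 1 c1 x * D 1 u x + c1 x * D 2 u x)))"
    by (intro has_slope_add has_slope_mult s us C)
  have g2_eq: "g2 x = ((D 2 a1 x * D 2 u x + D 1 a1 x * D 3 u x) + (D 1 a1 x * D 3 u x + a1 x * D 4 u x))
        + ((D 2 b1 x * D 1 u x + D 1 b1 x * D 2 u x) + (D 1 b1 x * D 2 u x + b1 x * D 3 u x))
        + ((D 2 c1 x * u x + D 1 c1 x * D 1 u x) + (D 1 c1 x * D 1 u x + c1 x * D 2 u x))"
    by (rule has_slope_unique[OF g2 has_slope_cong[OF h2] x]) (simp_all add: g1_eq)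
  show ?thesis
    unfolding L_def A4_def A3_def A2_def A1_def A0_def g2_eq g1_eq[OF x] g[OF x]
    by (simp add: algebra_simps)
qed

lemma continuous_eq_on_closed:
  fixes f g :: "real \<Rightarrow> real"
  assumes f: "continuous_on Ibar f" and g: "continuous_on Ibar g"
    and eq: "\<forall>x\<in>{-1<..<1}. f x = g x" and x: "x \<in> Ibar"
  shows "f x = g x"
proof -
  have cl: "closure {-1<..<1} = Ibar" by (rule closure_greaterThanLessThan) simp
  have "f x - g x = 0"
    by (rule continuous_constant_on_closure[of "{-1<..<1}" "\<lambda>x. f x - g x"])
      (use eq x in \<open>auto simp: cl intro!: continuous_intros f g\<close>)
  then show ?thesis by simp
qed

text \<open>
  Both factors of the fourth order operator come with their own positive solution. Dividing the
  inner result \<open>g = L\<^sub>1 \<phi>\<close> by \<open>v\<^sub>2\<close> and the eigenfunction \<open>\<phi>\<close> by \<open>v\<^sub>1\<close> introduces the additional factors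
  \<open>v\<^sub>2\<close> and \<open>v\<^sub>1\<close> in the second weight of the chain and in the weight of its right hand side.
\<close>

locale clamped_problem =
  f1: sturm_factor a1 b1 c1 v1 v1' B1 + f2: sturm_factor a2 b2 c2 v2 v2' B2
  for a1 b1 c1 v1 v1' B1 a2 b2 c2 v2 v2' B2 +
  assumes smooth: "C_on 2 Ibar a1" "C_on 2 Ibar b1" "C_on 2 Ibar c1"
    "continuous_on Ibar b2" "continuous_on Ibar c2"
begin

sublocale weighted_chain f1.inner_weight "\<lambda>x. f1.outer_weight x * v2 x" f2.inner_weight "\<lambda>x. f2.outer_weight x * v1 x"
  by unfold_locales
    (auto intro!: continuous_on_mult f1.weights_continuous f2.weights_continuous
      f1.weights_pos f2.weights_pos mult_pos_pos f1.v_pos f2.v_pos)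

abbreviation Lop :: "(real \<Rightarrow> real) \<Rightarrow> real \<Rightarrow> real" where
  "Lop \<equiv> L a1 b1 c1 a2 b2 c2"

text \<open>
  The equation is given on the open interval only and extends to the end points because all
  functions involved are continuous there. The clamped conditions on \<open>\<phi>\<close> become the vanishing of
  \<open>w = \<phi> / v\<^sub>1\<close> and of the weighted Wronskian \<open>z\<^sub>1\<close> at both ends.
\<close>

lemma quotient_equation:
  assumes ef: "is_eigenfunction Lop \<mu> \<phi>" and x: "x \<in> Ibar"
  defines "w \<equiv> \<lambda>x. \<phi> x / v1 x"
  shows "continuous_on Ibar w" "w x = \<mu> * T w x"
proof -
  have C4: "C_on 4 Ibar \<phi>" and bc: "\<phi> (-1) = 0" "\<phi> 1 = 0" "D 1 \<phi> (-1) = 0" "D 1 \<phi> 1 = 0"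
    and eq: "\<forall>x\<in>{-1<..<1}. Lop \<phi> x = \<mu> * \<phi> x"
    using ef unfolding is_eigenfunction_def by blast+
  have \<phi>s: "has_slope \<phi> (D 1 \<phi>)" "has_slope (D 1 \<phi>) (D 2 \<phi>)"
    using D_slope[of 0 \<phi>] D_slope[of 1 \<phi>] C_on_le[OF C4]
    by (simp_all del: C_on.simps add: numeral_2_eq_2)
  note \<phi>c = has_slope_continuous[OF \<phi>s(1)]
  define g where "g x = a1 x * D 2 \<phi> x + b1 x * D 1 \<phi> x + c1 x * \<phi> x" for x
  have \<phi>2: "C_on 2 Ibar \<phi>" "C_on 2 Ibar (D 1 \<phi>)" "C_on 2 Ibar (D 2 \<phi>)"
    using C_on_le[OF C4, of 2] C_on_D[of 2 1 \<phi>] C_on_le[OF C4, of 3] C_on_D[of 2 2 \<phi>] C4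
    by (simp_all del: C_on.simps add: eval_nat_numeral)
  have "C_on 2 Ibar (\<lambda>x. (a1 x * D 2 \<phi> x + 1 * (b1 x * D 1 \<phi> x)) + 1 * (c1 x * \<phi> x))"
    by (intro C_on_add C_on_mult smooth \<phi>2)
  then have gC: "C_on 2 Ibar g" by (simp del: C_on.simps add: g_def[abs_def])
  define g1 where "g1 = D 1 g"
  define g2 where "g2 = D 2 g"
  have gs: "has_slope g g1" "has_slope g1 g2"
    using D_slope[of 0 g] D_slope[of 1 g] C_on_le[OF gC, of 1] gC
    by (simp_all del: C_on.simps add: numeral_2_eq_2 g1_def g2_def)
  have "C_on (0 + 2) Ibar g" using gC by (simp only: add_0)
  then have g2c: "continuous_on Ibar g2"
    unfolding g2_def by (rule C_on_continuous[OF C_on_D])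
  have Lg: "Lop \<phi> x = a2 x * g2 x + b2 x * g1 x + c2 x * g x" if "x \<in> Ibar" for x
    by (rule L_as_composition[OF smooth(1-3) C4 _ gs that]) (simp add: g_def)
  have rhs: "a2 x * g2 x + b2 x * g1 x + c2 x * g x = \<mu> * \<phi> x" if "x \<in> Ibar" for x
  proof (rule continuous_eq_on_closed[OF _ _ _ that])
    show "continuous_on Ibar (\<lambda>x. a2 x * g2 x + b2 x * g1 x + c2 x * g x)"
      by (intro continuous_on_add continuous_on_mult f2.a_cont smooth g2c has_slope_continuous[OF gs(1)]
          has_slope_continuous[OF gs(2)])
    show "continuous_on Ibar (\<lambda>x. \<mu> * \<phi> x)" by (intro continuous_intros \<phi>c)
    show "\<forall>x\<in>{-1<..<1}. a2 x * g2 x + b2 x * g1 x + c2 x * g x = \<mu> * \<phi> x"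
      using eq Lg by simp
  qed
  show wc: "continuous_on Ibar w"
    unfolding w_def by (rule continuous_on_divide[OF \<phi>c f1.weights_continuous(3)]) (simp add: f1.nonzero)
  define z1 where "z1 x = exp (B1 x) * (D 1 \<phi> x * v1 x + -1 * (\<phi> x * v1' x))" for x
  define z2 where "z2 x = g x / v2 x" for x
  define z3 where "z3 x = exp (B2 x) * (g1 x * v2 x + -1 * (g x * v2' x))" for x
  have "has_slope w (\<lambda>x. f1.inner_weight x * z1 x)"
    unfolding w_def z1_def by (rule f1.factor(1)[OF \<phi>s])
  moreover have "has_slope z1 (\<lambda>x. f1.outer_weight x * v2 x * z2 x)"
    unfolding z1_def
    by (rule has_slope_cong[OF f1.factor(2)[OF \<phi>s]]) (simp_all add: z2_def g_def f2.nonzero)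
  moreover have "has_slope z2 (\<lambda>x. f2.inner_weight x * z3 x)"
    unfolding z2_def z3_def by (rule f2.factor(1)[OF gs])
  moreover have "has_slope z3 (\<lambda>x. f2.outer_weight x * (\<mu> * \<phi> x))"
    unfolding z3_def by (rule has_slope_cong[OF f2.factor(2)[OF gs]]) (simp_all add: rhs)
  moreover have "w (-1) = 0" "w 1 = 0" "z1 (-1) = 0" "z1 1 = 0"
    using bc by (simp_all add: w_def z1_def)
  ultimately have c: "clamped w z1 z2 z3 (\<lambda>x. f2.outer_weight x * (\<mu> * \<phi> x))"
    by (simp add: clamped_def)
  have "T (\<lambda>x. \<mu> * w x) x = w x"
  proof (rule T_unique[OF c _ _ x])
    show "continuous_on Ibar (\<lambda>x. \<mu> * w x)" by (rule continuous_on_mult_left[OF wc])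
  qed (simp add: w_def f1.nonzero)
  then show "w x = \<mu> * T w x" using T_scale[OF wc x] by simp
qed

text \<open>
  The eigenfunction is written with \<open>T w\<close> instead of the proportional \<open>w\<close>, because the chain makes
  \<open>T w\<close> differentiable with known derivatives. Its smoothness comes from \<open>C_on_solution\<close>, applied to
  \<open>g = L\<^sub>1 \<phi>\<close> and then to \<open>\<phi>\<close>.
\<close>

lemma eigenfunction_from_eigen:
  assumes w: "eigen \<rho> w" and \<rho>: "\<rho> \<noteq> 0" and nz: "\<exists>x\<in>Ibar. w x \<noteq> 0"
  shows "is_eigenfunction Lop (1 / \<rho>) (\<lambda>x. v1 x * T w x)"
proof -
  have wc: "continuous_on Ibar w" and we: "\<And>x. x \<in> Ibar \<Longrightarrow> T w x = \<rho> * w x"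
    using w by (auto simp: eigen_def)
  obtain z1 z2 z3 where c: "clamped (T w) z1 z2 z3 (\<lambda>x. f2.outer_weight x * v1 x * w x)"
    using T_solves[OF wc] by blast
  have s: "has_slope (T w) (\<lambda>x. f1.inner_weight x * z1 x)" "has_slope z1 (\<lambda>x. f1.outer_weight x * v2 x * z2 x)"
    "has_slope z2 (\<lambda>x. f2.inner_weight x * z3 x)" "has_slope z3 (\<lambda>x. f2.outer_weight x * v1 x * w x)"
    and bc: "T w (-1) = 0" "T w 1 = 0" "z1 (-1) = 0" "z1 1 = 0"
    using c unfolding clamped_def by blast+
  define \<phi> where "\<phi> x = v1 x * T w x" for x
  define \<phi>1 where "\<phi>1 x = v1' x * T w x + z1 x / (v1 x * exp (B1 x))" for x
  define g where "g x = v2 x * z2 x" for x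
  define g1 where "g1 x = v2' x * z2 x + z3 x / (v2 x * exp (B2 x))" for x
  have s2: "has_slope z1 (\<lambda>x. f1.outer_weight x * g x)"
    by (rule has_slope_cong[OF s(2)]) (simp_all add: g_def)
  have s4: "has_slope z3 (\<lambda>x. f2.outer_weight x * (v1 x * w x))"
    by (rule has_slope_cong[OF s(4)]) simp_all
  have \<phi>s: "has_slope \<phi> \<phi>1" "has_slope \<phi>1 (\<lambda>x. (g x - b1 x * \<phi>1 x - c1 x * \<phi> x) / a1 x)"
    using f1.unfactor[OF s(1) s2] by (simp_all add: \<phi>_def[abs_def] \<phi>1_def[abs_def])
  have gs: "has_slope g g1" "has_slope g1 (\<lambda>x. (v1 x * w x - b2 x * g1 x - c2 x * g x) / a2 x)"
    using f2.unfactor[OF s(3) s4] by (simp_all add: g_def[abs_def] g1_def[abs_def])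
  have "C_on (Suc (Suc 0)) Ibar g"
    by (rule C_on_solution[OF gs])
      (simp_all add: f2.a_cont smooth f2.nonzero continuous_on_mult f1.weights_continuous wc)
  then have g2: "C_on 2 Ibar g" by (simp only: numeral_2_eq_2)
  have "Suc (Suc 2) = 4" by simp
  moreover have "C_on (Suc (Suc 2)) Ibar \<phi>"
    by (rule C_on_solution[OF \<phi>s smooth(1-3) _ g2]) (simp add: f1.nonzero)
  ultimately have \<phi>4: "C_on 4 Ibar \<phi>" by (simp only:)
  have D1: "D 1 \<phi> x = \<phi>1 x" if "x \<in> Ibar" for x
    using deriv_on_eq[OF \<phi>s(1) that] by simp
  have "has_slope (D 1 \<phi>) (\<lambda>x. (g x - b1 x * \<phi>1 x - c1 x * \<phi> x) / a1 x)"
    by (rule has_slope_cong[OF \<phi>s(2)]) (simp_all add: deriv_on_eq[OF \<phi>s(1)])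
  from deriv_on_eq[OF this]
  have D2: "D 2 \<phi> x = (g x - b1 x * \<phi>1 x - c1 x * \<phi> x) / a1 x" if "x \<in> Ibar" for x
    using that by (simp add: numeral_2_eq_2)
  have "Lop \<phi> x = 1 / \<rho> * \<phi> x" if x: "x \<in> Ibar" for x
  proof -
    have "g x = a1 x * D 2 \<phi> x + b1 x * D 1 \<phi> x + c1 x * \<phi> x" if "x \<in> Ibar" for x
      using f1.nonzero(2)[OF that] by (simp add: D1[OF that, simplified] D2[OF that])
    from L_as_composition[OF smooth(1-3) \<phi>4 this gs x]
    have "Lop \<phi> x = v1 x * w x" using f2.nonzero(2)[OF x] by simp
    then show ?thesis using we[OF x] \<rho> by (simp add: \<phi>_def)
  qed
  moreover have "\<phi> (-1) = 0" "\<phi> 1 = 0" using bc by (simp_all add: \<phi>_def)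
  moreover have "D 1 \<phi> (-1) = 0" "D 1 \<phi> 1 = 0" 
    using D1[of "-1"] D1[of 1] bc by (simp_all add: \<phi>1_def)
  moreover have "\<exists>x\<in>Ibar. \<phi> x \<noteq> 0"
  proof -
    obtain y where y: "y \<in> Ibar" "w y \<noteq> 0" using nz by blast
    have "\<phi> y \<noteq> 0" using y \<rho> we f1.nonzero by (simp add: \<phi>_def)
    then show ?thesis using y by blast
  qed
  ultimately have "is_eigenfunction Lop (1 / \<rho>) \<phi>"
    using \<phi>4 unfolding is_eigenfunction_def by auto
  then show ?thesis by (simp add: \<phi>_def[abs_def])
qed

lemma eigen_of_eigenfunction:
  assumes ef: "is_eigenfunction Lop \<mu> \<phi>" and \<mu>: "\<mu> \<noteq> 0"
  shows "eigen (1 / \<mu>) (\<lambda>x. \<phi> x / v1 x)"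
  unfolding eigen_def
proof (intro conjI ballI)
  show "continuous_on Ibar (\<lambda>x. \<phi> x / v1 x)" by (rule quotient_equation(1)[OF ef, of 0]) simp
  have solve: "t = 1 / \<mu> * s" if "s = \<mu> * t" for s t using that \<mu> by simp
  show "T (\<lambda>x. \<phi> x / v1 x) x = 1 / \<mu> * (\<phi> x / v1 x)" if "x \<in> Ibar" for x
    by (rule solve[OF quotient_equation(2)[OF ef that]])
qed

text \<open>
  A function that is positive in the open interval and solves \<open>w = \<mu> T w\<close> forces \<open>\<mu> \<noteq> 0\<close>, so
  \<open>1 / \<mu>\<close> is an eigenvalue of \<open>T\<close> with a nonnegative eigenfunction; this excludes negative \<open>\<mu>\<close> and leaves only
  one value.
\<close>

theorem principal_eigenvalue:
  "\<exists>\<mu>1 \<phi>1.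
      \<mu>1 > 0 \<and>
      is_eigenfunction Lop \<mu>1 \<phi>1 \<and>
      (\<forall>x\<in>{-1<..<1}. \<phi>1 x > 0) \<and>
      (\<forall>\<mu> \<phi>. is_eigenfunction Lop \<mu> \<phi> \<and> (\<forall>x\<in>{-1<..<1}. \<phi> x > 0) \<longrightarrow> \<mu> = \<mu>1) \<and>
      (\<forall>\<phi>. is_eigenfunction Lop \<mu>1 \<phi> \<longrightarrow> (\<exists>k. \<forall>x\<in>{-1..1}. \<phi> x = k * \<phi>1 x))"
proof -
  obtain \<rho> w where w: "eigen \<rho> w" "nonneg_nonzero w" by (rule positive_eigenfunction_exists)
  have \<rho>: "0 < \<rho>" by (rule eigenvalue_pos[OF w])
  have wc: "continuous_on Ibar w" and we: "\<And>x. x \<in> Ibar \<Longrightarrow> T w x = \<rho> * w x"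
    and wn: "\<forall>x\<in>Ibar. 0 \<le> w x" "\<exists>x\<in>Ibar. w x \<noteq> 0"
    using w by (auto simp: eigen_def nonneg_nonzero_def)
  define \<phi>1 where "\<phi>1 x = v1 x * T w x" for x
  have ef: "is_eigenfunction Lop (1 / \<rho>) \<phi>1"
    using eigenfunction_from_eigen[OF w(1) _ wn(2)] \<rho> by (simp add: \<phi>1_def[abs_def])
  have pos: "\<phi>1 x > 0" if x: "x \<in> {-1<..<1}" for x
  proof -
    obtain \<delta> where \<delta>: "0 < \<delta>" "\<forall>x\<in>Ibar. \<delta> * envelope x \<le> T w x"
      using T_lower[OF wc wn(1)] wn(2) by blast
    have "0 < \<delta> * envelope x" using \<delta>(1) envelope_pos[OF x] by simp
    also have "\<dots> \<le> T w x" using \<delta>(2) x by auto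
    finally show ?thesis using f1.v_pos[of x] x by (simp add: \<phi>1_def)
  qed
  have unique: "\<mu> = 1 / \<rho>"
    if e: "is_eigenfunction Lop \<mu> \<phi>" and p: "\<forall>x\<in>{-1<..<1}. \<phi> x > 0" for \<mu> \<phi>
  proof -
    define u where "u x = \<phi> x / v1 x" for x
    have b: "\<phi> (-1) = 0" "\<phi> 1 = 0" using e by (simp_all add: is_eigenfunction_def)
    have un: "0 \<le> u x" if "x \<in> Ibar" for x
    proof (cases "x \<in> {-1<..<1}")
      case True
      then show ?thesis using p f1.v_pos[OF that] by (auto simp: u_def intro: less_imp_le)
    next
      case False
      then have "x = -1 \<or> x = 1" using that by auto
      then show ?thesis using b by (auto simp: u_def)
    qed
    have u0: "0 < u 0" using p f1.v_pos[of 0] by (simp add: u_def)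
    have nn: "nonneg_nonzero u" 
      unfolding nonneg_nonzero_def using un u0 by (intro conjI ballI bexI[of _ 0]) auto
    have "u 0 = \<mu> * T u 0" using quotient_equation(2)[OF e, of 0] by (simp add: u_def[abs_def])
    then have "\<mu> \<noteq> 0" using u0 by auto
    then have "eigen (1 / \<mu>) u"
      using eigen_of_eigenfunction[OF e] by (simp add: u_def[abs_def])
    then have "1 / \<mu> = \<rho>" by (rule positive_eigenvalue_unique[OF _ nn w])
    then show ?thesis by auto
  qed
  have simple: "\<exists>k. \<forall>x\<in>Ibar. \<phi> x = k * \<phi>1 x" if e: "is_eigenfunction Lop (1 / \<rho>) \<phi>" for \<phi>
  proof -
    have "eigen \<rho> (\<lambda>x. \<phi> x / v1 x)" using eigen_of_eigenfunction[OF e] \<rho> by simp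
    then obtain k where k: "\<forall>x\<in>Ibar. \<phi> x / v1 x = k * w x"
      by (rule positive_eigenvalue_simple[OF w])
    have "\<phi> x = (k / \<rho>) * \<phi>1 x" if x: "x \<in> Ibar" for x
      using bspec[OF k x] f1.nonzero(1)[OF x] \<rho> we[OF x] by (simp add: \<phi>1_def field_simps)
    then show ?thesis by blast
  qed
  show ?thesis
    by (rule exI[of _ "1 / \<rho>"], rule exI[of _ \<phi>1], intro conjI allI impI ballI ef pos)
      (use \<rho> unique simple in auto)
qed

end

theorem theorem4p6:
  fixes a1 b1 c1 a2 b2 c2 :: "real \<Rightarrow> real" and \<eta> :: real
  assumes "\<And>f. f \<in> {a1, b1, c1, a2, b2, c2} \<Longrightarrow> C_on 4 {-1..1} f"
    and "\<eta> > 0"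
    and "\<And>x. x \<in> {-1..1} \<Longrightarrow> min (a1 x) (a2 x) \<ge> \<eta>"
    and "\<And>x. x \<in> {-1..1} \<Longrightarrow> max (c1 x) (c2 x) \<le> 0"
  shows "\<exists>\<mu>1 \<phi>1.
      \<mu>1 > 0 \<and>
      is_eigenfunction (L a1 b1 c1 a2 b2 c2) \<mu>1 \<phi>1 \<and>
      (\<forall>x\<in>{-1<..<1}. \<phi>1 x > 0) \<and>
      (\<forall>\<mu> \<phi>. is_eigenfunction (L a1 b1 c1 a2 b2 c2) \<mu> \<phi> \<and> (\<forall>x\<in>{-1<..<1}. \<phi> x > 0)
         \<longrightarrow> \<mu> = \<mu>1) \<and>
      (\<forall>\<phi>. is_eigenfunction (L a1 b1 c1 a2 b2 c2) \<mu>1 \<phi>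
         \<longrightarrow> (\<exists>k. \<forall>x\<in>{-1..1}. \<phi> x = k * \<phi>1 x))"
proof -
  have C: "C_on 4 Ibar a1" "C_on 4 Ibar b1" "C_on 4 Ibar c1"
    "C_on 4 Ibar a2" "C_on 4 Ibar b2" "C_on 4 Ibar c2"
    by (rule assms(1), blast)+
  have a: "0 < a1 x" "0 < a2 x" if "x \<in> Ibar" for x
    using assms(2) assms(3)[OF that] by (auto simp: min_def split: if_splits)
  have c: "c1 x \<le> 0" "c2 x \<le> 0" if "x \<in> Ibar" for x
    using assms(4)[OF that] by simp_all
  obtain v1 v1' B1 where 1: "sturm_factor a1 b1 c1 v1 v1' B1"
    using sturm_factor_exists[OF C_on_continuous[OF C(1)] C_on_continuous[OF C(2)]
        C_on_continuous[OF C(3)] a(1) c(1)] by blast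
  obtain v2 v2' B2 where 2: "sturm_factor a2 b2 c2 v2 v2' B2"
    using sturm_factor_exists[OF C_on_continuous[OF C(4)] C_on_continuous[OF C(5)]
        C_on_continuous[OF C(6)] a(2) c(2)] by blast
  have "clamped_problem a1 b1 c1 v1 v1' B1 a2 b2 c2 v2 v2' B2"
    using 1 2 C_on_le[OF C(1), of 2] C_on_le[OF C(2), of 2] C_on_le[OF C(3), of 2]
      C_on_continuous[OF C(5)] C_on_continuous[OF C(6)]
    unfolding clamped_problem_def clamped_problem_axioms_def by (simp del: C_on.simps)
  then show ?thesis by (rule clamped_problem.principal_eigenvalue)
qed

end
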